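(* Let $0<\beta\leq 1$ and $0<\alpha<1$ be fixed. For every $H\in\mathcal{B}_0$, the random variable $h(H,G(n,\beta,\alpha))$ converges to $R(\beta,\alpha,H)$ in probability as $n\to\infty$. Consequently the graph parameter $R(\beta,\alpha):H\mapsto R(\beta,\alpha,H)$ belongs to $\mathcal{L}$.
   Context: Bipartite setting. $\mathcal{B}$ is the set of (isomorphism classes of) finite graphs $H$ whose vertex set is partitioned into two labelled classes $V_1(H),V_2(H)$, with edge set $E(H)\subseteq V_1(H)\times V_2(H)$. Homomorphisms preserve the labels $1,2$; $\mathrm{Hom}(H,G)$ is the set of homomorphisms from $H$ to $G$. $\mathcal{B}_0$ is the set of $G\in\mathcal{B}$ with $E(G)\neq\emptyset$. $P_1$ is the single edge. For $H\in\mathcal{B}$, $G\in\mathcal{B}_0$ put $t(H,G)=|\mathrm{Hom}(H,G)|\,|V_1(G)|^{-|V_1(H)|}|V_2(G)|^{-|V_2(H)|}$, $d(H,G)=-\log t(H,G)$, and, for $H,G\in\mathcal{B}_0$, $h(H,G)=d(H,G)/d(P_1,G)$; if $E(G)=V_1(G)\times V_2(G)$ (so $d(P_1,G)=0$), set $h(H,G):=|E(H)|$. If $G$ has no edges, $h(H,G)$ is undefined and is treated as the symbol $\infty$ (convergence in probability is understood for random variables with values in $\mathbb{R}\cup\{\infty\}$). $\mathcal{L}$ is the closure, in $\mathbb{R}^{\mathcal{B}_0}$ with the product topology, of the set of vectors $\tau(G)=(h(H,G))_{H\in\mathcal{B}_0}$, $G\in\mathcal{B}_0$. $G(n,\beta,\alpha)$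 is the random graph $G\in\mathcal{B}$ with $|V_1(G)|=\lceil n^{\alpha}\rceil$, $|V_2(G)|=\lceil n^{1-\alpha}\rceil$ in which each pair $(v,w)\in V_1(G)\times V_2(G)$ is an edge independently with probability $n^{\beta-1}$. Let $\alpha_1=\alpha$, $\alpha_2=1-\alpha$. For $H\in\mathcal{B}_0$ and $\beta<1$, $R(\beta,\alpha,H)$ is the minimum of $$|E(H')|+(1-\beta)^{-1}\sum_{i=1}^2(|V_i(H)|-|V_i(H')|)\alpha_i$$ over all homomorphic images $H'$ of $H$, i.e. all $H'\in\mathcal{B}$ admitting a homomorphism $H\to H'$ that is surjective on the vertices and on the edges of $H'$. For $\beta=1$, $R(1,\alpha,H):=|E(H)|$. *)

theory Defs
  imports "HOL-Probability.Probability"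
begin

text \<open>
  Finite graphs with two labelled vertex classes.  The classes are separate sorts: a number
  may occur both in \<open>V1\<close> and in \<open>V2\<close>, where it denotes two different vertices.
  Vertices are natural numbers, so every isomorphism class of finite such graphs has a
  representative.  Isomorphic representatives are not identified; all parameters below depend
  on the isomorphism class only.
\<close>

datatype bigraph = Bigraph (V1: "nat set") (V2: "nat set") (edges: "(nat \<times> nat) set")

definition bigraphs :: "bigraph set" where
  "bigraphs = {G. finite (V1 G) \<and> finite (V2 G) \<and> edges G \<subseteq> V1 G \<times> V2 G}"

definition bigraphs0 :: "bigraph set" where
  "bigraphs0 = {G \<in> bigraphs. edges G \<noteq> {}}"

definition P1 :: bigraph where
  "P1 = Bigraph {0} {0} {(0, 0)}"

text \<open>
  The maps are extensional, so that a homomorphism is determined by its values on the vertices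
  and \<open>card (Hom H G)\<close> is the number of homomorphisms.
\<close>

definition Hom :: "bigraph \<Rightarrow> bigraph \<Rightarrow> ((nat \<Rightarrow> nat) \<times> (nat \<Rightarrow> nat)) set" where
  "Hom H G = {(f1, f2). f1 \<in> V1 H \<rightarrow>\<^sub>E V1 G \<and> f2 \<in> V2 H \<rightarrow>\<^sub>E V2 G \<and>
     (\<forall>(v, w) \<in> edges H. (f1 v, f2 w) \<in> edges G)}"

definition hom_density :: "bigraph \<Rightarrow> bigraph \<Rightarrow> real" where
  "hom_density H G = real (card (Hom H G)) /
     (real (card (V1 G)) ^ card (V1 H) * real (card (V2 G)) ^ card (V2 H))"

definition log_density :: "bigraph \<Rightarrow> bigraph \<Rightarrow> real" where
  "log_density H G = - ln (hom_density H G)"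

definition log_ratio :: "bigraph \<Rightarrow> bigraph \<Rightarrow> real" where
  "log_ratio H G = (if edges G = V1 G \<times> V2 G then real (card (edges H))
     else log_density H G / log_density P1 G)"

text \<open>
  The extension of \<open>log_ratio H\<close>, which is meaningful only for graphs with an edge, to all
  bigraphs.
\<close>

definition log_ratio_ext :: "bigraph \<Rightarrow> bigraph \<Rightarrow> ereal" where
  "log_ratio_ext H G = (if edges G = {} then \<infinity> else ereal (log_ratio H G))"

text \<open>
  Points of the product space indexed by \<open>bigraphs0\<close> are extensional functions, which
  are \<open>undefined\<close> outside the index set.
\<close>

definition tau :: "bigraph \<Rightarrow> bigraph \<Rightarrow> real" where
  "tau G = (\<lambda>H \<in> bigraphs0. log_ratio H G)"

definition limit_params :: "(bigraph \<Rightarrow> real) set" where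
  "limit_params = product_topology (\<lambda>_. euclideanreal) bigraphs0 closure_of (tau ` bigraphs0)"

definition bigraph_pmf :: "nat \<Rightarrow> real \<Rightarrow> real \<Rightarrow> bigraph pmf" where
  "bigraph_pmf n \<beta> \<alpha> =
     (let A = {..<nat \<lceil>real n powr \<alpha>\<rceil>}; B = {..<nat \<lceil>real n powr (1 - \<alpha>)\<rceil>}
      in map_pmf (\<lambda>e. Bigraph A B {x \<in> A \<times> B. e x})
           (Pi_pmf (A \<times> B) False (\<lambda>_. bernoulli_pmf (real n powr (\<beta> - 1)))))"

text \<open>
  Convergence in probability to a finite constant; the random variables may live on different
  probability spaces.  At a point where the random variable is \<open>\<infinity>\<close>, the distance to
  the constant is \<open>\<infinity>\<close>.
\<close>

definition conv_in_prob :: "(nat \<Rightarrow> 'a pmf) \<Rightarrow> (nat \<Rightarrow> 'a \<Rightarrow> ereal) \<Rightarrow> real \<Rightarrow> bool" where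
  "conv_in_prob M X c \<longleftrightarrow>
     (\<forall>\<epsilon>>0. (\<lambda>n. measure_pmf.prob (M n) {\<omega>. \<bar>X n \<omega> - ereal c\<bar> > ereal \<epsilon>}) \<longlonglongrightarrow> 0)"

definition hom_images :: "bigraph \<Rightarrow> bigraph set" where
  "hom_images H = {H' \<in> bigraphs. \<exists>(f1, f2) \<in> Hom H H'.
     f1 ` V1 H = V1 H' \<and> f2 ` V2 H = V2 H' \<and> map_prod f1 f2 ` edges H = edges H'}"

text \<open>
  \<open>hom_images H\<close> is an infinite set of representatives, but for finite \<open>H\<close> the set of
  values minimised over is finite: the cardinalities are bounded by those of \<open>H\<close>.
\<close>

definition R :: "real \<Rightarrow> real \<Rightarrow> bigraph \<Rightarrow> real" where
  "R \<beta> \<alpha> H = (if \<beta> = 1 then real (card (edges H))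
     else Min ((\<lambda>H'. real (card (edges H')) + inverse (1 - \<beta>) *
            ((real (card (V1 H)) - real (card (V1 H'))) * \<alpha> +
             (real (card (V2 H)) - real (card (V2 H'))) * (1 - \<alpha>))) ` hom_images H))"

end

theory Submission
  imports Defs "HOL-Real_Asymp.Real_Asymp"
begin

text \<open>
  Write \<open>t\<close> for the homomorphism density and \<open>r = (1 - \<beta>) R(\<beta>, \<alpha>, H)\<close>.  Then
  \<open>t(H, G) = n powr (- r + o(1))\<close> with high probability, and dividing by the same estimate for
  the single edge, whose parameter is \<open>1\<close>, gives the limit.

  The upper bound on \<open>t\<close> is Markov's inequality: a map with image \<open>H'\<close> is a homomorphism with
  probability \<open>n powr (- (1 - \<beta>) |E(H')|)\<close>, and such maps are a fraction of order
  \<open>n powr (- \<Sum>i. \<alpha>\<^sub>i (|V\<^sub>i(H)| - |V\<^sub>i(H')|))\<close> of all maps.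
  For the lower bound, take an optimal image \<open>K\<close> and count its injective homomorphisms into \<open>G\<close>.
  By optimality no subgraph of \<open>K\<close> is too dense to be concentrated, so Chebyshev's inequality applies.
\<close>

section \<open>Sums over extensional maps: image sizes and injectivity\<close>

lemma sum_PiE_insert:
  assumes "x \<notin> S"
  shows "(\<Sum>f\<in>insert x S \<rightarrow>\<^sub>E A. F f) = (\<Sum>f\<in>S \<rightarrow>\<^sub>E A. \<Sum>y\<in>A. F (f(x := y)))"
proof -
  have "(\<Sum>f\<in>insert x S \<rightarrow>\<^sub>E A. F f) = (\<Sum>(y, f)\<in>A \<times> (S \<rightarrow>\<^sub>E A). F (f(x := y)))"
    unfolding PiE_insert_eq
    using inj_combinator[OF assms, of "\<lambda>_. A"]
    by (subst sum.reindex) (auto simp: case_prod_unfold)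
  also have "\<dots> = (\<Sum>y\<in>A. \<Sum>f\<in>S \<rightarrow>\<^sub>E A. F (f(x := y)))"
    by (simp add: sum.cartesian_product)
  also have "\<dots> = (\<Sum>f\<in>S \<rightarrow>\<^sub>E A. \<Sum>y\<in>A. F (f(x := y)))"
    by (rule sum.swap)
  finally show ?thesis .
qed

lemma image_fun_upd_notin: "x \<notin> S \<Longrightarrow> (f(x := y)) ` insert x S = insert y (f ` S)"
  by auto

text \<open>When \<open>f\<close> is extended to \<open>x\<close>, at most \<open>card S\<close>
  values repeat an old one, each adding a factor \<open>card A\<close> to the weight, and at most
  \<open>card A\<close> values are new and leave the weight unchanged. So each step multiplies the
  sum by at most \<open>Suc (card S) * card A\<close>. The weights are those that the first moment
  puts on maps with collapsed vertices.\<close>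

lemma sum_card_power_deficit_le:
  assumes "finite S" "finite A"
  shows "(\<Sum>f\<in>S \<rightarrow>\<^sub>E A. real (card A) ^ (card S - card (f ` S))) \<le> fact (card S) * real (card A) ^ card S"
  using assms(1)
proof (induction S rule: finite_induct)
  case empty
  then show ?case by simp
next
  case (insert x S)
  let ?N = "real (card A)"
  have inner: "(\<Sum>y\<in>A. ?N ^ (card (insert x S) - card ((f(x := y)) ` insert x S)))
      \<le> real (Suc (card S)) * ?N * ?N ^ (card S - card (f ` S))"
    if f: "f \<in> S \<rightarrow>\<^sub>E A" for f
  proof -
    let ?E = "?N ^ (card S - card (f ` S))"
    have le: "card (f ` S) \<le> card S" by (rule card_image_le) fact
    have sub: "f ` S \<subseteq> A" using f by auto
    have "(\<Sum>y\<in>A. ?N ^ (card (insert x S) - card ((f(x := y)) ` insert x S)))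
        = (\<Sum>y\<in>A. if y \<in> f ` S then ?N * ?E else ?E)"
      using insert.hyps le
      by (intro sum.cong refl) (simp add: image_fun_upd_notin insert_absorb Suc_diff_le del: fun_upd_apply image_insert)
    also have "\<dots> = real (card (f ` S)) * (?N * ?E) + real (card (A - f ` S)) * ?E"
      using assms(2) sub by (simp add: sum.If_cases Int_absorb1 flip: Diff_eq)
    also have "\<dots> \<le> real (card S) * (?N * ?E) + ?N * ?E"
      using le assms(2) by (intro add_mono mult_right_mono) (auto intro: card_mono)
    finally show ?thesis by (simp add: algebra_simps)
  qed
  have "(\<Sum>f\<in>insert x S \<rightarrow>\<^sub>E A. ?N ^ (card (insert x S) - card (f ` insert x S)))
      \<le> (\<Sum>f\<in>S \<rightarrow>\<^sub>E A. real (Suc (card S)) * ?N * ?N ^ (card S - card (f ` S)))"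
    unfolding sum_PiE_insert[OF insert.hyps(2)] by (intro sum_mono inner)
  also have "\<dots> = real (Suc (card S)) * ?N * (\<Sum>f\<in>S \<rightarrow>\<^sub>E A. ?N ^ (card S - card (f ` S)))"
    by (simp add: sum_distrib_left)
  also have "\<dots> \<le> real (Suc (card S)) * ?N * (fact (card S) * ?N ^ card S)"
    by (intro mult_left_mono insert.IH) auto
  also have "\<dots> = fact (card (insert x S)) * ?N ^ card (insert x S)"
    using insert.hyps by (simp add: algebra_simps)
  finally show ?case .
qed

text \<open>Greedy choice: the values used so far occupy at most half of \<open>A\<close>, so each
  new vertex keeps at least \<open>card A / 2\<close> free values. The count is written as a sum of
  indicators so that \<open>sum_PiE_insert\<close> can drive the induction.\<close>

lemma card_inj_PiE_ge:
  assumes "finite S" "finite A" "2 * card S \<le> card A"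
  shows "(real (card A) / 2) ^ card S \<le> real (card {f \<in> S \<rightarrow>\<^sub>E A. inj_on f S})"
proof -
  have "(real (card A) / 2) ^ card S \<le> (\<Sum>f\<in>S \<rightarrow>\<^sub>E A. of_bool (inj_on f S))"
    using assms(1,3)
  proof (induction S rule: finite_induct)
    case empty
    then show ?case by simp
  next
    case (insert x S)
    have inner: "real (card A) / 2 * of_bool (inj_on f S) \<le> (\<Sum>y\<in>A. of_bool (inj_on (f(x := y)) (insert x S)))"
      if f: "f \<in> S \<rightarrow>\<^sub>E A" for f
    proof (cases "inj_on f S")
      case True
      have "real (card A) / 2 \<le> real (card (A - f ` S))"
      proof -
        have "card (f ` S) \<le> card S" by (rule card_image_le) fact
        moreover have "card A - card (f ` S) \<le> card (A - f ` S)"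
          by (rule diff_card_le_card_Diff) (use insert.hyps in auto)
        ultimately show ?thesis using insert.prems insert.hyps by simp
      qed
      also have "\<dots> = (\<Sum>y\<in>A - f ` S. 1)" by simp
      also have "\<dots> \<le> (\<Sum>y\<in>A - f ` S. of_bool (inj_on (f(x := y)) (insert x S)))"
      proof (rule sum_mono)
        fix y assume "y \<in> A - f ` S"
        then have "inj_on (f(x := y)) (insert x S)"
          using True insert.hyps by (auto simp: inj_on_def)
        then show "(1::real) \<le> of_bool (inj_on (f(x := y)) (insert x S))" by (simp del: inj_on_insert)
      qed
      also have "\<dots> \<le> (\<Sum>y\<in>A. of_bool (inj_on (f(x := y)) (insert x S)))"
        by (rule sum_mono2) (use assms in auto)
      finally show ?thesis using True by simp
    qed (simp add: sum_nonneg)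
    have "(real (card A) / 2) ^ card (insert x S) = real (card A) / 2 * (real (card A) / 2) ^ card S"
      using insert.hyps by simp
    also have "\<dots> \<le> real (card A) / 2 * (\<Sum>f\<in>S \<rightarrow>\<^sub>E A. of_bool (inj_on f S))"
      using insert.prems insert.hyps by (intro mult_left_mono insert.IH) auto
    also have "\<dots> \<le> (\<Sum>f\<in>insert x S \<rightarrow>\<^sub>E A. of_bool (inj_on f (insert x S)))"
      unfolding sum_PiE_insert[OF insert.hyps(2)] sum_distrib_left by (intro sum_mono inner)
    finally show ?case .
  qed
  also have "\<dots> = real (card {f \<in> S \<rightarrow>\<^sub>E A. inj_on f S})"
    using assms by (simp add: sum_of_bool_eq finite_PiE Int_def)
  finally show ?thesis .
qed

section \<open>The binomial random bipartite graph with arbitrary finite classes and edge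
  probability\<close>

definition binomial_bigraph :: "nat set \<Rightarrow> nat set \<Rightarrow> real \<Rightarrow> bigraph pmf" where
  "binomial_bigraph A B p = map_pmf (\<lambda>e. Bigraph A B {x \<in> A \<times> B. e x})
     (Pi_pmf (A \<times> B) False (\<lambda>_. bernoulli_pmf p))"

lemma set_binomial_bigraphD:
  assumes "G \<in> set_pmf (binomial_bigraph A B p)"
  shows "V1 G = A" "V2 G = B" "edges G \<subseteq> A \<times> B"
  using assms by (auto simp: binomial_bigraph_def)

lemma finite_set_binomial_bigraph:
  assumes "finite A" "finite B"
  shows "finite (set_pmf (binomial_bigraph A B p))"
proof (rule finite_subset)
  show "set_pmf (binomial_bigraph A B p) \<subseteq> Bigraph A B ` Pow (A \<times> B)"
    by (auto simp: binomial_bigraph_def)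
qed (use assms in auto)

lemma prob_binomial_bigraph_edges:
  assumes "finite A" "finite B" "0 \<le> p" "p \<le> 1" "S \<subseteq> A \<times> B"
  shows "measure_pmf.prob (binomial_bigraph A B p) {G. S \<subseteq> edges G} = p ^ card S"
proof -
  \<comment> \<open>The event is a product event: coordinates in \<open>S\<close> are forced to be
    edges, all others are free.\<close>
  let ?B = "\<lambda>x. if x \<in> S then {True} else UNIV"
  have "measure_pmf.prob (binomial_bigraph A B p) {G. S \<subseteq> edges G}
      = measure_pmf.prob (Pi_pmf (A \<times> B) False (\<lambda>_. bernoulli_pmf p)) (Pi (A \<times> B) ?B)"
    unfolding binomial_bigraph_def measure_map_pmf
    by (rule arg_cong[where f = "measure_pmf.prob _"]) (use assms(5) in \<open>auto simp: Pi_iff split: if_splits\<close>)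
  also have "\<dots> = (\<Prod>x\<in>A \<times> B. measure_pmf.prob (bernoulli_pmf p) (?B x))"
    using assms by (intro measure_Pi_pmf_Pi) auto
  also have "\<dots> = (\<Prod>x\<in>A \<times> B. if x \<in> S then p else 1)"
    using assms by (intro prod.cong refl) (auto simp: measure_pmf_single)
  also have "\<dots> = p ^ card S"
    using assms by (simp add: prod.If_cases Int_absorb1 flip: prod.inter_restrict)
  finally show ?thesis .
qed

lemma expectation_binomial_bigraph_edges:
  assumes "finite A" "finite B" "0 \<le> p" "p \<le> 1" "S \<subseteq> A \<times> B"
  shows "measure_pmf.expectation (binomial_bigraph A B p) (\<lambda>G. of_bool (S \<subseteq> edges G)) = p ^ card S"
proof -
  have "measure_pmf.expectation (binomial_bigraph A B p) (\<lambda>G. of_bool (S \<subseteq> edges G) :: real)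
      = measure_pmf.expectation (binomial_bigraph A B p) (indicator {G. S \<subseteq> edges G})"
    by (rule arg_cong[where f = "measure_pmf.expectation _"]) (auto simp: fun_eq_iff)
  then show ?thesis using prob_binomial_bigraph_edges[OF assms] by simp
qed

text \<open>A sum of indicators of edge sets is what linearity of expectation needs. Restricting
  \<open>G\<close> to the support makes the index set of the sum independent of
  \<open>G\<close>.\<close>

lemma card_Hom_eq_sum:
  assumes H: "H \<in> bigraphs" and G: "G \<in> set_pmf (binomial_bigraph A B p)" and fin: "finite A" "finite B"
  shows "real (card (Hom H G)) = (\<Sum>(f, g)\<in>(V1 H \<rightarrow>\<^sub>E A) \<times> (V2 H \<rightarrow>\<^sub>E B).
    of_bool (map_prod f g ` edges H \<subseteq> edges G))"
proof -
  have "Hom H G = {(f, g) \<in> (V1 H \<rightarrow>\<^sub>E A) \<times> (V2 H \<rightarrow>\<^sub>E B). map_prod f g ` edges H \<subseteq> edges G}"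
    unfolding Hom_def using set_binomial_bigraphD[OF G] by auto
  moreover have "finite ((V1 H \<rightarrow>\<^sub>E A) \<times> (V2 H \<rightarrow>\<^sub>E B))"
    using H fin by (auto simp: bigraphs_def intro!: finite_PiE)
  ultimately show ?thesis
    by (simp only: case_prod_unfold sum_of_bool_eq) (rule arg_cong[where f = "\<lambda>X. real (card X)"], auto)
qed

section \<open>Homomorphic images, their cost, and optimal images\<close>

lemma hom_imagesD:
  assumes "H' \<in> hom_images H" "H \<in> bigraphs"
  shows "card (V1 H') \<le> card (V1 H)" "card (V2 H') \<le> card (V2 H)" "card (edges H') \<le> card (edges H)"
    "H' \<in> bigraphs"
proof -
  have fin: "finite (V1 H)" "finite (V2 H)" "finite (edges H)"
    using assms(2) by (auto simp: bigraphs_def intro: finite_subset)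
  from assms(1) obtain f g where "f ` V1 H = V1 H'" "g ` V2 H = V2 H'" "map_prod f g ` edges H = edges H'"
    "H' \<in> bigraphs"
    by (auto simp: hom_images_def)
  then show "card (V1 H') \<le> card (V1 H)" "card (V2 H') \<le> card (V2 H)" "card (edges H') \<le> card (edges H)"
    "H' \<in> bigraphs"
    using fin by (metis card_image_le)+
qed

text \<open>Arbitrary total maps are allowed here; restricting them to the vertex classes gives the
  extensional pair that \<open>Hom\<close> demands.\<close>

lemma image_in_hom_images:
  assumes "H \<in> bigraphs"
  shows "Bigraph (f ` V1 H) (g ` V2 H) (map_prod f g ` edges H) \<in> hom_images H"
proof -
  let ?K = "Bigraph (f ` V1 H) (g ` V2 H) (map_prod f g ` edges H)"
  let ?f = "restrict f (V1 H)" and ?g = "restrict g (V2 H)"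
  have E: "edges H \<subseteq> V1 H \<times> V2 H" using assms by (auto simp: bigraphs_def)
  then have *: "map_prod ?f ?g ` edges H = map_prod f g ` edges H"
    by (intro image_cong refl) auto
  have "(?f, ?g) \<in> Hom H ?K"
    using E unfolding Hom_def by (auto simp: subset_iff)
  moreover have "?K \<in> bigraphs"
    using assms E by (auto simp: bigraphs_def)
  moreover have "?f ` V1 H = f ` V1 H" "?g ` V2 H = g ` V2 H" by auto
  ultimately show ?thesis
    unfolding hom_images_def using * by (auto intro!: bexI[of _ "(?f, ?g)"])
qed

lemma hom_images_refl: "H \<in> bigraphs \<Longrightarrow> H \<in> hom_images H"
  using image_in_hom_images[of H id id] by (cases H) (simp add: map_prod.id)

text \<open>Compose the two surjections. This lets a contraction of an optimal image compete in the
  minimum defining \<open>R\<close>.\<close>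

lemma hom_images_trans_image:
  assumes "K \<in> hom_images H" "H \<in> bigraphs"
  shows "Bigraph (f ` V1 K) (g ` V2 K) (map_prod f g ` edges K) \<in> hom_images H"
proof -
  from assms(1) obtain f' g' where "f' ` V1 H = V1 K" "g' ` V2 H = V2 K" "map_prod f' g' ` edges H = edges K"
    by (auto simp: hom_images_def)
  then have "(f \<circ> f') ` V1 H = f ` V1 K" "(g \<circ> g') ` V2 H = g ` V2 K"
    "map_prod (f \<circ> f') (g \<circ> g') ` edges H = map_prod f g ` edges K"
    by (metis image_comp map_prod_compose)+
  then show ?thesis
    using image_in_hom_images[OF assms(2), of "f \<circ> f'" "g \<circ> g'"] by simp
qed

text \<open>The quantity minimised in \<open>R\<close>, for one candidate image.\<close>

definition image_cost :: "real \<Rightarrow> real \<Rightarrow> bigraph \<Rightarrow> bigraph \<Rightarrow> real" where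
  "image_cost \<beta> \<alpha> H H' = real (card (edges H')) + inverse (1 - \<beta>) *
     ((real (card (V1 H)) - real (card (V1 H'))) * \<alpha> +
      (real (card (V2 H)) - real (card (V2 H'))) * (1 - \<alpha>))"

text \<open>The right-hand side is, up to sign, the exponent of n in the expected fraction of maps
  that are homomorphisms with image of the shape \<open>K\<close>: the first summand is the price of
  the edges, the second the price of identifying vertices.\<close>

lemma image_cost_scaled:
  assumes "\<beta> \<noteq> 1"
  shows "(1 - \<beta>) * image_cost \<beta> \<alpha> H K = (1 - \<beta>) * real (card (edges K)) +
    ((real (card (V1 H)) - real (card (V1 K))) * \<alpha> + (real (card (V2 H)) - real (card (V2 K))) * (1 - \<alpha>))"
proof -
  have "(1 - \<beta>) * (inverse (1 - \<beta>) * x) = x" for x using assms by simp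
  then show ?thesis by (simp only: image_cost_def distrib_left[of "1 - \<beta>"])
qed

lemma R_eq_Min: "\<beta> \<noteq> 1 \<Longrightarrow> R \<beta> \<alpha> H = Min (image_cost \<beta> \<alpha> H ` hom_images H)"
  by (simp add: R_def image_cost_def)

text \<open>The cost depends on three cardinalities only, each bounded by that of
  \<open>H\<close>.\<close>

lemma finite_image_cost:
  assumes "H \<in> bigraphs"
  shows "finite (image_cost \<beta> \<alpha> H ` hom_images H)"
proof (rule finite_subset)
  show "image_cost \<beta> \<alpha> H ` hom_images H
    \<subseteq> (\<lambda>(e, v, w). real e + inverse (1 - \<beta>) * ((real (card (V1 H)) - real v) * \<alpha> +
          (real (card (V2 H)) - real w) * (1 - \<alpha>))) ` ({..card (edges H)} \<times> {..card (V1 H)} \<times> {..card (V2 H)})"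
  proof (rule image_subsetI)
    fix K assume "K \<in> hom_images H"
    from hom_imagesD[OF this assms]
    show "image_cost \<beta> \<alpha> H K \<in> (\<lambda>(e, v, w). real e + inverse (1 - \<beta>) * ((real (card (V1 H)) - real v) * \<alpha> +
          (real (card (V2 H)) - real w) * (1 - \<alpha>))) ` ({..card (edges H)} \<times> {..card (V1 H)} \<times> {..card (V2 H)})"
      by (intro image_eqI[of _ _ "(card (edges K), card (V1 K), card (V2 K))"]) (auto simp: image_cost_def)
  qed
qed auto

lemma R_le_image_cost:
  assumes "H \<in> bigraphs" "\<beta> \<noteq> 1" "K \<in> hom_images H"
  shows "R \<beta> \<alpha> H \<le> image_cost \<beta> \<alpha> H K"
  using assms finite_image_cost[OF assms(1)] by (simp add: R_eq_Min)

lemma R_attained: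
  assumes "H \<in> bigraphs" "\<beta> \<noteq> 1"
  obtains K where "K \<in> hom_images H" "R \<beta> \<alpha> H = image_cost \<beta> \<alpha> H K"
proof -
  have "R \<beta> \<alpha> H \<in> image_cost \<beta> \<alpha> H ` hom_images H"
    unfolding R_eq_Min[OF assms(2)]
    using finite_image_cost[OF assms(1)] hom_images_refl[OF assms(1)] by (intro Min_in) auto
  then show ?thesis using that by auto
qed

text \<open>Every image of a single edge is a single edge. This value fixes the growth of the
  denominator \<open>log_density P1 G\<close> as (1 - \<beta>) ln n.\<close>

lemma R_P1:
  assumes "\<beta> \<noteq> 1"
  shows "R \<beta> \<alpha> P1 = 1"
proof -
  have P: "P1 \<in> bigraphs" by (simp add: P1_def bigraphs_def)
  obtain K where K: "K \<in> hom_images P1" "R \<beta> \<alpha> P1 = image_cost \<beta> \<alpha> P1 K"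
    using R_attained[OF P assms] by blast
  from K(1) obtain f g where "f ` V1 P1 = V1 K" "g ` V2 P1 = V2 K" "map_prod f g ` edges P1 = edges K"
    by (auto simp: hom_images_def)
  then have "V1 K = {f 0}" "V2 K = {g 0}" "edges K = {(f 0, g 0)}"
    by (auto simp: P1_def)
  then show ?thesis using K(2) by (simp add: image_cost_def P1_def)
qed

text \<open>A subgraph of an optimal image cannot be too dense, since contracting it to a
  single edge would otherwise give a cheaper image.\<close>

lemma optimal_image_subgraph:
  assumes H: "H \<in> bigraphs" and \<beta>: "\<beta> < 1"
    and K: "K \<in> hom_images H" "R \<beta> \<alpha> H = image_cost \<beta> \<alpha> H K"
    and F: "F \<subseteq> edges K" "F \<noteq> {}"
  shows "(1 - \<beta>) * real (card F) + \<beta> \<le> real (card (fst ` F)) * \<alpha> + real (card (snd ` F)) * (1 - \<alpha>)"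
proof -
  have Kb: "finite (V1 K)" "finite (V2 K)" "edges K \<subseteq> V1 K \<times> V2 K" "finite (edges K)"
    using hom_imagesD(4)[OF K(1) H] by (auto simp: bigraphs_def intro: finite_subset)
  \<comment> \<open>Choosing an edge of \<open>F\<close> as the target makes all of \<open>F\<close>
    collapse onto that edge, while vertices outside \<open>F\<close> stay fixed.\<close>
  obtain v w where vw: "(v, w) \<in> F" using F(2) by auto
  define f where "f = (\<lambda>x. if x \<in> fst ` F then v else x)"
  define g where "g = (\<lambda>x. if x \<in> snd ` F then w else x)"
  define L where "L = Bigraph (f ` V1 K) (g ` V2 K) (map_prod f g ` edges K)"
  have L: "L \<in> hom_images H"
    unfolding L_def using K(1) H by (rule hom_images_trans_image)
  have contract: "real (card (h ` V)) = real (card V) - real (card S) + 1"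
    if "finite V" "S \<subseteq> V" "u \<in> S" "h = (\<lambda>x. if x \<in> S then u else x)" for V S u and h :: "nat \<Rightarrow> nat"
  proof -
    have "h ` V = insert u (V - S)" using that by auto
    then have "card (h ` V) = Suc (card (V - S))" using that by simp
    then show ?thesis
      using that card_mono[OF that(1,2)] by (simp add: card_Diff_subset finite_subset of_nat_diff)
  qed
  have 1: "real (card (V1 L)) = real (card (V1 K)) - real (card (fst ` F)) + 1"
    unfolding L_def bigraph.sel
    by (rule contract[of _ _ v]) (use Kb F vw f_def in \<open>force+\<close>)
  have 2: "real (card (V2 L)) = real (card (V2 K)) - real (card (snd ` F)) + 1"
    unfolding L_def bigraph.sel
    by (rule contract[of _ _ w]) (use Kb F vw g_def in \<open>force+\<close>)
  \<comment> \<open>All edges of \<open>F\<close> become the one edge \<open>(v, w)\<close>.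
    Contraction may also merge edges outside \<open>F\<close>, hence only an inequality.\<close>
  have 3: "card (edges L) + card F \<le> card (edges K) + 1"
  proof -
    have "edges L \<subseteq> insert (v, w) (map_prod f g ` (edges K - F))"
    proof
      fix e assume "e \<in> edges L"
      then obtain x y where xy: "(x, y) \<in> edges K" "e = (f x, g y)" by (auto simp: L_def)
      show "e \<in> insert (v, w) (map_prod f g ` (edges K - F))"
      proof (cases "(x, y) \<in> F")
        case True
        then have "x \<in> fst ` F" "y \<in> snd ` F" by force+
        then show ?thesis using xy by (simp add: f_def g_def)
      next
        case False
        then show ?thesis using xy by auto
      qed
    qed
    then have "card (edges L) \<le> card (insert (v, w) (map_prod f g ` (edges K - F)))"
      using Kb by (intro card_mono) auto
    also have "\<dots> \<le> Suc (card (map_prod f g ` (edges K - F)))" by (rule card_insert_le_m1) auto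
    also have "\<dots> \<le> Suc (card (edges K - F))" using Kb by (simp add: card_image_le)
    also have "\<dots> = Suc (card (edges K) - card F)" using Kb F by (simp add: card_Diff_subset finite_subset)
    finally show ?thesis using card_mono[OF Kb(4) F(1)] by simp
  qed
  \<comment> \<open>Compare \<open>K\<close> with its contraction \<open>L\<close>. What remains of
    \<open>F\<close> is one vertex in each class, of weight \<alpha> + (1 - \<alpha>) = 1, and one
    edge, of weight 1 - \<beta>; their difference is the summand \<beta> of the claim.\<close>
  have "(1 - \<beta>) * image_cost \<beta> \<alpha> H K \<le> (1 - \<beta>) * image_cost \<beta> \<alpha> H L"
    using R_le_image_cost[OF H _ L, of \<beta> \<alpha>] K(2) \<beta> by (intro mult_left_mono) auto
  moreover have "(1 - \<beta>) * (real (card (edges L)) + real (card F)) \<le> (1 - \<beta>) * (real (card (edges K)) + 1)"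
    using 3 \<beta> by (intro mult_left_mono) auto
  ultimately show ?thesis
    using \<beta> image_cost_scaled[of \<beta> \<alpha> H K] image_cost_scaled[of \<beta> \<alpha> H L]
    by (simp add: 1 2 algebra_simps)
qed

section \<open>First and second moments of homomorphism counts\<close>

lemma expectation_hom_density_le:
  assumes H: "H \<in> bigraphs" and \<beta>: "\<beta> < 1" and \<alpha>: "0 \<le> \<alpha>" "\<alpha> \<le> 1" and n: "1 \<le> n"
    and fin: "finite A" "finite B"
    and A: "real n powr \<alpha> \<le> real (card A)" and B: "real n powr (1 - \<alpha>) \<le> real (card B)"
  shows "measure_pmf.expectation (binomial_bigraph A B (real n powr (\<beta> - 1))) (hom_density H)
    \<le> fact (card (V1 H)) * fact (card (V2 H)) * real n powr (- (1 - \<beta>) * R \<beta> \<alpha> H)"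
proof -
  let ?p = "real n powr (\<beta> - 1)"
  let ?M = "binomial_bigraph A B ?p"
  let ?a = "card (V1 H)" and ?b = "card (V2 H)"
  let ?D = "real (card A) ^ ?a * real (card B) ^ ?b"
  have finH: "finite (V1 H)" "finite (V2 H)" "edges H \<subseteq> V1 H \<times> V2 H"
    using H by (auto simp: bigraphs_def)
  have p: "0 \<le> ?p" "?p \<le> 1"
    using n \<beta> powr_mono[of "\<beta> - 1" 0 "real n"] by auto
  have pos: "0 < real (card A)" "0 < real (card B)"
    using n by (auto intro!: less_le_trans[OF _ A] less_le_trans[OF _ B] simp del: of_nat_0_less_iff)
  have integr [simp]: "integrable (measure_pmf ?M) (X :: _ \<Rightarrow> real)" for X
    by (intro integrable_measure_pmf_finite finite_set_binomial_bigraph fin)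
  \<comment> \<open>The image of H under \<open>(f, g)\<close> costs at least \<open>R\<close>.
    Solving this for the edge part bounds the probability by the target power of n times one factor
    \<open>card A\<close> or \<open>card B\<close> for each vertex lost. Only lower bounds on the
    class sizes are needed, since the vertex deficits enter with positive exponents.\<close>
  have term_le: "?p ^ card (map_prod f g ` edges H) \<le> real n powr (- (1 - \<beta>) * R \<beta> \<alpha> H) *
      (real (card A) ^ (?a - card (f ` V1 H)) * real (card B) ^ (?b - card (g ` V2 H)))" for f g :: "nat \<Rightarrow> nat"
  proof -
    let ?K = "Bigraph (f ` V1 H) (g ` V2 H) (map_prod f g ` edges H)"
    define s where "s = ?a - card (f ` V1 H)"
    define t where "t = ?b - card (g ` V2 H)"
    define e where "e = card (map_prod f g ` edges H)"
    have st: "real ?a - real (card (f ` V1 H)) = real s" "real ?b - real (card (g ` V2 H)) = real t"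
      using finH by (simp_all add: s_def t_def card_image_le of_nat_diff)
    have "R \<beta> \<alpha> H \<le> image_cost \<beta> \<alpha> H ?K"
      using R_le_image_cost[OF H _ image_in_hom_images[OF H]] \<beta> by auto
    also have "\<dots> = real e + inverse (1 - \<beta>) * (real s * \<alpha> + real t * (1 - \<alpha>))"
      by (simp add: image_cost_def st e_def)
    finally have "(1 - \<beta>) * R \<beta> \<alpha> H \<le> (1 - \<beta>) * (real e + inverse (1 - \<beta>) * (real s * \<alpha> + real t * (1 - \<alpha>)))"
      using \<beta> by (intro mult_left_mono) auto
    also have "\<dots> = (1 - \<beta>) * real e + (real s * \<alpha> + real t * (1 - \<alpha>))"
      using \<beta> by (simp add: field_simps)
    finally have ex: "(\<beta> - 1) * real e \<le> - (1 - \<beta>) * R \<beta> \<alpha> H + (\<alpha> * real s + (1 - \<alpha>) * real t)"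
      by (simp add: algebra_simps)
    have "?p ^ e = real n powr ((\<beta> - 1) * real e)"
      using n by (simp add: powr_powr flip: powr_realpow)
    also have "\<dots> \<le> real n powr (- (1 - \<beta>) * R \<beta> \<alpha> H + (\<alpha> * real s + (1 - \<alpha>) * real t))"
      using n ex by (intro powr_mono) auto
    also have "\<dots> = real n powr (- (1 - \<beta>) * R \<beta> \<alpha> H) * ((real n powr \<alpha>) ^ s * (real n powr (1 - \<alpha>)) ^ t)"
      using n by (simp add: powr_add powr_powr flip: powr_realpow)
    also have "\<dots> \<le> real n powr (- (1 - \<beta>) * R \<beta> \<alpha> H) * (real (card A) ^ s * real (card B) ^ t)"
      using A B by (intro mult_left_mono mult_mono power_mono) auto
    finally show ?thesis by (simp add: s_def t_def e_def)
  qed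
  have "measure_pmf.expectation ?M (hom_density H)
      = measure_pmf.expectation ?M (\<lambda>G. (\<Sum>(f, g)\<in>(V1 H \<rightarrow>\<^sub>E A) \<times> (V2 H \<rightarrow>\<^sub>E B).
          of_bool (map_prod f g ` edges H \<subseteq> edges G)) / ?D)"
    by (intro integral_cong_AE) (auto simp: AE_measure_pmf_iff hom_density_def set_binomial_bigraphD card_Hom_eq_sum[OF H _ fin])
  also have "\<dots> = (\<Sum>(f, g)\<in>(V1 H \<rightarrow>\<^sub>E A) \<times> (V2 H \<rightarrow>\<^sub>E B).
          measure_pmf.expectation ?M (\<lambda>G. of_bool (map_prod f g ` edges H \<subseteq> edges G))) / ?D"
    by (simp add: case_prod_unfold)
  also have "\<dots> = (\<Sum>(f, g)\<in>(V1 H \<rightarrow>\<^sub>E A) \<times> (V2 H \<rightarrow>\<^sub>E B). ?p ^ card (map_prod f g ` edges H)) / ?D"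
  proof (intro arg_cong2[where f = "(/)"] sum.cong refl, clarsimp)
    fix f g assume "f \<in> V1 H \<rightarrow>\<^sub>E A" "g \<in> V2 H \<rightarrow>\<^sub>E B"
    then have "map_prod f g ` edges H \<subseteq> A \<times> B" using finH by auto
    then show "measure_pmf.expectation ?M (\<lambda>G. of_bool (map_prod f g ` edges H \<subseteq> edges G))
        = ?p ^ card (map_prod f g ` edges H)"
      using expectation_binomial_bigraph_edges[OF fin p] by blast
  qed
  also have "\<dots> \<le> (\<Sum>(f, g)\<in>(V1 H \<rightarrow>\<^sub>E A) \<times> (V2 H \<rightarrow>\<^sub>E B). real n powr (- (1 - \<beta>) * R \<beta> \<alpha> H) *
      (real (card A) ^ (?a - card (f ` V1 H)) * real (card B) ^ (?b - card (g ` V2 H)))) / ?D"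
    using term_le by (intro divide_right_mono sum_mono) auto
  \<comment> \<open>The bound is a function of \<open>f\<close> times a function of
    \<open>g\<close>, so the double sum factors and the two classes can be treated
    separately.\<close>
  also have "\<dots> = real n powr (- (1 - \<beta>) * R \<beta> \<alpha> H) *
      ((\<Sum>f\<in>V1 H \<rightarrow>\<^sub>E A. real (card A) ^ (?a - card (f ` V1 H))) *
       (\<Sum>g\<in>V2 H \<rightarrow>\<^sub>E B. real (card B) ^ (?b - card (g ` V2 H)))) / ?D"
    unfolding sum_product sum.cartesian_product by (simp only: sum_distrib_left case_prod_unfold)
  also have "\<dots> \<le> real n powr (- (1 - \<beta>) * R \<beta> \<alpha> H) *
      ((fact ?a * real (card A) ^ ?a) * (fact ?b * real (card B) ^ ?b)) / ?D"
    using finH fin by (intro divide_right_mono mult_left_mono mult_mono sum_card_power_deficit_le) (auto intro!: sum_nonneg)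
  also have "\<dots> = fact ?a * fact ?b * real n powr (- (1 - \<beta>) * R \<beta> \<alpha> H)"
    using pos by simp
  finally show ?thesis .
qed

text \<open>The second moment method for the number of injective homomorphisms \<open>K \<rightarrow> G\<close>.
  A pair \<open>\<phi>, \<psi>\<close> contributes to the variance only if the two copies of \<open>K\<close> share edges;
  the shared edges form a subgraph \<open>F\<close> of the second copy, and \<open>\<psi>\<close> maps the vertices of \<open>F\<close>
  into the boundedly many vertices of the first copy.\<close>

lemma prob_few_homs_le:
  fixes p L :: real
  assumes K: "K \<in> bigraphs" and fin: "finite A" "finite B" and p: "0 < p" "p \<le> 1" and L: "0 < L"
    and A: "0 < card A" "2 * card (V1 K) \<le> card A" and B: "0 < card B" "2 * card (V2 K) \<le> card B"
    and dense: "\<And>F. F \<subseteq> edges K \<Longrightarrow> F \<noteq> {} \<Longrightarrow>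
      L \<le> real (card A) ^ card (fst ` F) * real (card B) ^ card (snd ` F) * p ^ card F"
  shows "measure_pmf.prob (binomial_bigraph A B p)
      {G. real (card (Hom K G)) \<le> (real (card A) / 2) ^ card (V1 K) * (real (card B) / 2) ^ card (V2 K) * p ^ card (edges K) / 2}
    \<le> 4 * 2 ^ (card (V1 K) + card (V2 K) + card (edges K)) *
       real (card (V1 K) ^ card (V1 K) * card (V2 K) ^ card (V2 K)) / L"
proof -
  let ?M = "binomial_bigraph A B p"
  let ?a = "card (V1 K)" and ?b = "card (V2 K)" and ?e = "card (edges K)"
  let ?N = "real (card A)" and ?N' = "real (card B)"
  let ?W = "real (?a ^ ?a * ?b ^ ?b)"
  have finK: "finite (V1 K)" "finite (V2 K)" "edges K \<subseteq> V1 K \<times> V2 K" "finite (edges K)"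
    using K by (auto simp: bigraphs_def intro: finite_subset)
  \<comment> \<open>Restricting to injective pairs gives every copy of \<open>K\<close> exactly
    \<open>card (edges K)\<close> edges, so all copies are equally likely to appear.\<close>
  define I where "I = {f \<in> V1 K \<rightarrow>\<^sub>E A. inj_on f (V1 K)} \<times> {g \<in> V2 K \<rightarrow>\<^sub>E B. inj_on g (V2 K)}"
  define S where "S = (\<lambda>\<phi>. map_prod (fst \<phi>) (snd \<phi>) ` edges K :: (nat \<times> nat) set)"
  define X where "X = (\<lambda>G. \<Sum>\<phi>\<in>I. of_bool (S \<phi> \<subseteq> edges G) :: real)"
  define m where "m = real (card I) * p ^ ?e"
  have finI: "finite I"
    unfolding I_def
    by (intro finite_cartesian_product finite_Collect_conjI disjI1) (use finK fin in \<open>simp_all add: finite_PiE\<close>)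
  have I_le: "?N ^ ?a * ?N' ^ ?b \<le> 2 ^ (?a + ?b) * real (card I)"
  proof -
    have "(?N / 2) ^ ?a * (?N' / 2) ^ ?b \<le> real (card I)"
      unfolding I_def card_cartesian_product of_nat_mult
      using finK fin A B by (intro mult_mono card_inj_PiE_ge) auto
    then show ?thesis by (simp add: power_divide power_add field_simps)
  qed
  have I_pos: "0 < real (card I)"
  proof -
    have "0 < ?N ^ ?a * ?N' ^ ?b" using A B by simp
    also note I_le
    finally show ?thesis by (simp add: zero_less_mult_iff)
  qed
  have m_pos: "0 < m" using I_pos p by (simp add: m_def)
  have S_sub: "S \<phi> \<subseteq> A \<times> B" if "\<phi> \<in> I" for \<phi>
    using that finK(3) unfolding S_def I_def by auto
  have inj: "inj_on (map_prod (fst \<phi>) (snd \<phi>)) (edges K)" if "\<phi> \<in> I" for \<phi>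
    using that finK(3) unfolding I_def by (auto intro: inj_on_subset[OF map_prod_inj_on])
  have card_S: "card (S \<phi>) = ?e" if "\<phi> \<in> I" for \<phi>
    using inj[OF that] by (simp add: S_def card_image)
  have integr [simp]: "integrable (measure_pmf ?M) (Y :: _ \<Rightarrow> real)" for Y
    by (intro integrable_measure_pmf_finite finite_set_binomial_bigraph fin)
  have EX: "measure_pmf.expectation ?M X = m"
    unfolding X_def m_def
    using S_sub card_S expectation_binomial_bigraph_edges[OF fin, of p] p by (simp add: less_imp_le)
  have EX2: "measure_pmf.expectation ?M (\<lambda>G. (X G)\<^sup>2) = (\<Sum>\<phi>\<in>I. \<Sum>\<psi>\<in>I. p ^ card (S \<phi> \<union> S \<psi>))"
  proof -
    have "(\<lambda>G. (X G)\<^sup>2) = (\<lambda>G. \<Sum>\<phi>\<in>I. \<Sum>\<psi>\<in>I. of_bool (S \<phi> \<union> S \<psi> \<subseteq> edges G))"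
      unfolding X_def power2_eq_square sum_product by (intro ext sum.cong refl) auto
    moreover have "measure_pmf.expectation ?M (\<lambda>G. of_bool (S \<phi> \<union> S \<psi> \<subseteq> edges G)) = p ^ card (S \<phi> \<union> S \<psi>)"
      if "\<phi> \<in> I" "\<psi> \<in> I" for \<phi> \<psi>
      using S_sub that p by (intro expectation_binomial_bigraph_edges fin) auto
    ultimately show ?thesis by simp
  qed
  \<comment> \<open>The possible nonempty overlaps, read as sets of edges of \<open>K\<close>. Their
    number is bounded in terms of \<open>K\<close> alone, so a union bound over them costs only a
    constant.\<close>
  define \<F> where "\<F> = {F. F \<subseteq> edges K \<and> F \<noteq> {}}"
  have fin\<F>: "finite \<F>" and card\<F>: "card \<F> \<le> 2 ^ ?e"
  proof -
    have "\<F> \<subseteq> Pow (edges K)" by (auto simp: \<F>_def)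
    moreover have "finite (Pow (edges K))" using finK by simp
    ultimately show "finite \<F>" "card \<F> \<le> 2 ^ ?e"
      by (auto intro: finite_subset simp flip: card_Pow[OF finK(4)] intro!: card_mono)
  qed
  have pair: "p ^ card (S \<phi> \<union> S \<psi>) - p ^ (2 * ?e)
      \<le> (\<Sum>F\<in>\<F>. of_bool (map_prod (fst \<psi>) (snd \<psi>) ` F \<subseteq> S \<phi>) * (p ^ (2 * ?e) / p ^ card F))"
    (is "?l \<le> ?r") if "\<phi> \<in> I" "\<psi> \<in> I" for \<phi> \<psi>
  proof -
    \<comment> \<open>The edges that the second copy shares with the first. If there are none, the
      two copies are independent and the covariance is zero; otherwise this \<open>F\<close> is one
      of the summands on the right.\<close>
    define F where "F = {x \<in> edges K. map_prod (fst \<psi>) (snd \<psi>) x \<in> S \<phi>}"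
    have FK: "F \<subseteq> edges K" by (auto simp: F_def)
    have "h ` {x \<in> U. h x \<in> T} = T \<inter> h ` U" for h :: "nat \<times> nat \<Rightarrow> nat \<times> nat" and U T by auto
    then have im: "map_prod (fst \<psi>) (snd \<psi>) ` F = S \<phi> \<inter> S \<psi>" unfolding F_def by (simp only: S_def)
    have "card F = card (S \<phi> \<inter> S \<psi>)"
      unfolding im[symmetric] by (rule card_image[symmetric]) (rule inj_on_subset[OF inj[OF that(2)] FK])
    moreover have "card (S \<phi>) + card (S \<psi>) = card (S \<phi> \<union> S \<psi>) + card (S \<phi> \<inter> S \<psi>)"
      by (rule card_Un_Int) (use finK in \<open>auto simp: S_def\<close>)
    ultimately have un: "card (S \<phi> \<union> S \<psi>) + card F = 2 * ?e"
      using card_S that by simp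
    have eq: "p ^ card (S \<phi> \<union> S \<psi>) = p ^ (2 * ?e) / p ^ card F"
      using p unfolding un[symmetric] by (simp add: power_add)
    have r_nonneg: "0 \<le> ?r" using p by (intro sum_nonneg) auto
    show ?thesis
    proof (cases "F = {}")
      case True
      then show ?thesis using r_nonneg un by simp
    next
      case False
      then have "F \<in> \<F>" using FK by (simp add: \<F>_def)
      have "?l \<le> of_bool (map_prod (fst \<psi>) (snd \<psi>) ` F \<subseteq> S \<phi>) * (p ^ (2 * ?e) / p ^ card F)"
        using p by (simp add: eq im)
      also have "\<dots> \<le> ?r"
        by (rule member_le_sum[OF \<open>F \<in> \<F>\<close> _ fin\<F>]) (use p in auto)
      finally show ?thesis .
    qed
  qed
  \<comment> \<open>Each vertex of \<open>U\<close> loses its \<open>card C\<close> choices and gets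
    at most \<open>card V\<close> instead; \<open>card V ^ card V\<close> bounds the gain uniformly
    in \<open>U\<close>.\<close>
  have PiE_count: "real (card (\<Pi>\<^sub>E x\<in>V. if x \<in> U then f ` V else C)) \<le> real (card V ^ card V) * real (card C) ^ card V / real (card C) ^ card U"
    if "finite V" "U \<subseteq> V" "U \<noteq> {}" "0 < card C" for V U C :: "nat set" and f :: "nat \<Rightarrow> nat"
  proof -
    have VU: "card U \<le> card V" "0 < card V"
      using that by (auto intro: card_mono simp: card_gt_0_iff)
    have "card (\<Pi>\<^sub>E x\<in>V. if x \<in> U then f ` V else C) = (\<Prod>x\<in>V. if x \<in> U then card (f ` V) else card C)"
      unfolding card_PiE[OF that(1)] by (simp add: if_distrib[of card])
    also have "\<dots> = card (f ` V) ^ card U * card C ^ (card V - card U)"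
      using that by (simp add: prod.If_cases Int_absorb1 card_Diff_subset finite_subset flip: Diff_eq)
    also have "\<dots> \<le> card V ^ card V * card C ^ (card V - card U)"
    proof (intro mult_right_mono)
      have "card (f ` V) ^ card U \<le> card V ^ card U" using that by (intro power_mono card_image_le) auto
      also have "\<dots> \<le> card V ^ card V" using VU by (intro power_increasing) auto
      finally show "card (f ` V) ^ card U \<le> card V ^ card V" .
    qed simp
    finally have "real (card (\<Pi>\<^sub>E x\<in>V. if x \<in> U then f ` V else C)) \<le> real (card V ^ card V * card C ^ (card V - card U))"
      by (rule of_nat_mono)
    also have "real (card V ^ card V * card C ^ (card V - card U)) = real (card V ^ card V) * real (card C) ^ card V / real (card C) ^ card U"
      using VU that by (simp add: power_diff_conv_inverse divide_inverse power_inverse)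
    finally show ?thesis .
  qed
  have count: "(\<Sum>\<psi>\<in>I. of_bool (map_prod (fst \<psi>) (snd \<psi>) ` F \<subseteq> S \<phi>)) * (p ^ (2 * ?e) / p ^ card F)
      \<le> ?W * (?N ^ ?a * ?N' ^ ?b) * p ^ (2 * ?e) / L"
    if \<phi>: "\<phi> \<in> I" and F: "F \<in> \<F>" for \<phi> F
  proof -
    have F': "F \<subseteq> edges K" "F \<noteq> {}" using F by (auto simp: \<F>_def)
    have V: "fst ` F \<subseteq> V1 K" "fst ` F \<noteq> {}" "snd ` F \<subseteq> V2 K" "snd ` F \<noteq> {}"
      using F' finK(3) by auto
    let ?P = "\<Pi>\<^sub>E x\<in>V1 K. if x \<in> fst ` F then fst \<phi> ` V1 K else A"
    let ?Q = "\<Pi>\<^sub>E x\<in>V2 K. if x \<in> snd ` F then snd \<phi> ` V2 K else B"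
    have "(\<Sum>\<psi>\<in>I. of_bool (map_prod (fst \<psi>) (snd \<psi>) ` F \<subseteq> S \<phi>) :: real)
        = real (card {\<psi> \<in> I. map_prod (fst \<psi>) (snd \<psi>) ` F \<subseteq> S \<phi>})"
      using finI by (simp add: sum_of_bool_eq Int_def)
    also have "\<dots> \<le> real (card (?P \<times> ?Q))"
    proof (intro of_nat_mono card_mono)
      show "finite (?P \<times> ?Q)"
        using finK fin by (intro finite_cartesian_product finite_PiE) auto
      have "fst \<psi> x \<in> fst \<phi> ` V1 K" "snd \<psi> y \<in> snd \<phi> ` V2 K"
        if "map_prod (fst \<psi>) (snd \<psi>) ` F \<subseteq> S \<phi>" "(x, y) \<in> F" for \<psi> :: "(nat \<Rightarrow> nat) \<times> (nat \<Rightarrow> nat)" and x y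
      proof -
        have "(fst \<psi> x, snd \<psi> y) \<in> S \<phi>" using that by force
        then show "fst \<psi> x \<in> fst \<phi> ` V1 K" "snd \<psi> y \<in> snd \<phi> ` V2 K"
          using finK(3) by (auto simp: S_def)
      qed
      then have "fst \<psi> \<in> ?P \<and> snd \<psi> \<in> ?Q"
        if "\<psi> \<in> I" "map_prod (fst \<psi>) (snd \<psi>) ` F \<subseteq> S \<phi>" for \<psi>
        using that unfolding I_def PiE_iff by (auto simp: mem_Times_iff)
      then show "{\<psi> \<in> I. map_prod (fst \<psi>) (snd \<psi>) ` F \<subseteq> S \<phi>} \<subseteq> ?P \<times> ?Q"
        unfolding mem_Times_iff[symmetric] by blast
    qed
    also have "\<dots> = real (card ?P) * real (card ?Q)" by (simp add: card_cartesian_product)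
    also have "\<dots> \<le> (real (?a ^ ?a) * ?N ^ ?a / ?N ^ card (fst ` F)) * (real (?b ^ ?b) * ?N' ^ ?b / ?N' ^ card (snd ` F))"
      using finK V A B by (intro mult_mono PiE_count) auto
    also have "\<dots> = ?W * (?N ^ ?a * ?N' ^ ?b) / (?N ^ card (fst ` F) * ?N' ^ card (snd ` F))"
      by simp
    finally have "(\<Sum>\<psi>\<in>I. of_bool (map_prod (fst \<psi>) (snd \<psi>) ` F \<subseteq> S \<phi>)) * (p ^ (2 * ?e) / p ^ card F)
       \<le> ?W * (?N ^ ?a * ?N' ^ ?b) / (?N ^ card (fst ` F) * ?N' ^ card (snd ` F)) * (p ^ (2 * ?e) / p ^ card F)"
      using p by (intro mult_right_mono) auto
    also have "\<dots> = ?W * (?N ^ ?a * ?N' ^ ?b) * p ^ (2 * ?e) / (?N ^ card (fst ` F) * ?N' ^ card (snd ` F) * p ^ card F)"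
      by simp
    \<comment> \<open>The denominator is the order of the expected number of copies of the overlap
      \<open>F\<close>, which \<open>dense\<close> bounds below by \<open>L\<close>.\<close>
    also have "\<dots> \<le> ?W * (?N ^ ?a * ?N' ^ ?b) * p ^ (2 * ?e) / L"
      using dense[OF F'] L p by (intro divide_left_mono) auto
    finally show ?thesis .
  qed
  have "measure_pmf.variance ?M X = (\<Sum>\<phi>\<in>I. \<Sum>\<psi>\<in>I. p ^ card (S \<phi> \<union> S \<psi>)) - m\<^sup>2"
    using measure_pmf.variance_eq[of ?M X] by (simp add: EX EX2)
  also have "\<dots> = (\<Sum>\<phi>\<in>I. \<Sum>\<psi>\<in>I. p ^ card (S \<phi> \<union> S \<psi>) - p ^ (2 * ?e))"
    by (simp add: sum_subtractf m_def power_mult_distrib power2_eq_square power_add mult_2)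
  also have "\<dots> \<le> (\<Sum>\<phi>\<in>I. \<Sum>\<psi>\<in>I. \<Sum>F\<in>\<F>. of_bool (map_prod (fst \<psi>) (snd \<psi>) ` F \<subseteq> S \<phi>) * (p ^ (2 * ?e) / p ^ card F))"
    by (intro sum_mono pair)
  also have "\<dots> = (\<Sum>\<phi>\<in>I. \<Sum>F\<in>\<F>. (\<Sum>\<psi>\<in>I. of_bool (map_prod (fst \<psi>) (snd \<psi>) ` F \<subseteq> S \<phi>)) * (p ^ (2 * ?e) / p ^ card F))"
    unfolding sum_distrib_right by (intro sum.cong refl sum.swap)
  also have "\<dots> \<le> (\<Sum>\<phi>\<in>I. \<Sum>F\<in>\<F>. ?W * (?N ^ ?a * ?N' ^ ?b) * p ^ (2 * ?e) / L)"
    by (intro sum_mono count)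
  also have "\<dots> = real (card I) * (real (card \<F>) * (?W * (?N ^ ?a * ?N' ^ ?b) * p ^ (2 * ?e) / L))"
    by simp
  \<comment> \<open>Injective maps are a constant fraction of all maps; replacing the latter count
    by \<open>card I\<close> produces the second factor needed for the square of
    \<open>m\<close>.\<close>
  also have "\<dots> \<le> real (card I) * (2 ^ ?e * (?W * (2 ^ (?a + ?b) * real (card I)) * p ^ (2 * ?e) / L))"
  proof (intro mult_left_mono mult_mono)
    have "real (card \<F>) \<le> real (2 ^ ?e)" by (rule of_nat_mono) (fact card\<F>)
    then show "real (card \<F>) \<le> 2 ^ ?e" by simp
    show "?W * (?N ^ ?a * ?N' ^ ?b) * p ^ (2 * ?e) / L \<le> ?W * (2 ^ (?a + ?b) * real (card I)) * p ^ (2 * ?e) / L"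
      using p L by (intro divide_right_mono mult_right_mono mult_left_mono I_le) auto
  qed (use p L in auto)
  also have "\<dots> = m\<^sup>2 * (2 ^ (?a + ?b + ?e) * ?W / L)"
    by (simp add: m_def power2_eq_square power_add mult_2)
  finally have var: "measure_pmf.variance ?M X \<le> m\<^sup>2 * (2 ^ (?a + ?b + ?e) * ?W / L)" .
  \<comment> \<open>Since \<open>X\<close> counts only some of the homomorphisms and the threshold
    is at most \<open>m / 2\<close>, having few homomorphisms forces \<open>X\<close> to deviate
    from its mean \<open>m\<close> by at least \<open>m / 2\<close>.\<close>
  have "measure_pmf.prob ?M {G. real (card (Hom K G)) \<le> (?N / 2) ^ ?a * (?N' / 2) ^ ?b * p ^ ?e / 2}
      \<le> measure_pmf.prob ?M {G \<in> space ?M. m / 2 \<le> \<bar>X G - measure_pmf.expectation ?M X\<bar>}"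
  proof (rule measure_pmf.finite_measure_mono_AE; (simp only: AE_measure_pmf_iff mem_Collect_eq)?; (intro ballI impI)?)
    fix G assume G: "G \<in> set_pmf ?M" and le: "real (card (Hom K G)) \<le> (?N / 2) ^ ?a * (?N' / 2) ^ ?b * p ^ ?e / 2"
    have "X G \<le> real (card (Hom K G))"
      unfolding card_Hom_eq_sum[OF K G fin] X_def S_def case_prod_unfold
      by (rule sum_mono2) (use finK fin in \<open>auto simp: I_def intro!: finite_PiE\<close>)
    also note le
    also have "(?N / 2) ^ ?a * (?N' / 2) ^ ?b * p ^ ?e / 2 \<le> m / 2"
      using I_le p unfolding m_def
      by (intro divide_right_mono mult_right_mono) (auto simp: power_divide power_add field_simps)
    finally have "m / 2 \<le> \<bar>X G - measure_pmf.expectation ?M X\<bar>"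
      unfolding EX using m_pos by linarith
    then show "G \<in> space ?M \<and> m / 2 \<le> \<bar>X G - measure_pmf.expectation ?M X\<bar>" by simp
  qed simp
  also have "\<dots> \<le> measure_pmf.variance ?M X / (m / 2)\<^sup>2"
    by (rule measure_pmf.Chebyshev_inequality) (use m_pos in auto)
  also have "\<dots> \<le> m\<^sup>2 * (2 ^ (?a + ?b + ?e) * ?W / L) / (m / 2)\<^sup>2"
    by (intro divide_right_mono var) auto
  also have "\<dots> = 4 * 2 ^ (?a + ?b + ?e) * ?W / L"
    using m_pos by (simp add: power2_eq_square field_simps)
  finally show ?thesis .
qed

text \<open>Precomposition with the surjection from \<open>H\<close> onto \<open>K\<close> is
  injective on homomorphisms. It carries the lower bound from the optimal image over to
  \<open>H\<close>.\<close>

lemma card_Hom_image_le: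
  assumes H: "H \<in> bigraphs" and K: "K \<in> hom_images H" and G: "G \<in> bigraphs"
  shows "card (Hom K G) \<le> card (Hom H G)"
proof -
  obtain f g where fg: "f ` V1 H = V1 K" "g ` V2 H = V2 K" "map_prod f g ` edges H = edges K"
    using K by (auto simp: hom_images_def)
  have EH: "edges H \<subseteq> V1 H \<times> V2 H" using H by (auto simp: bigraphs_def)
  define \<Phi> where "\<Phi> = (\<lambda>(h, k). (restrict (h \<circ> f) (V1 H), restrict (k \<circ> g) (V2 H))
    :: (nat \<Rightarrow> nat) \<times> (nat \<Rightarrow> nat))"
  show ?thesis
  proof (rule card_inj_on_le)
    show "inj_on \<Phi> (Hom K G)"
    proof (rule inj_onI, clarify)
      fix h k h' k' assume hk: "(h, k) \<in> Hom K G" "(h', k') \<in> Hom K G" and eq: "\<Phi> (h, k) = \<Phi> (h', k')"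
      have "h (f x) = h' (f x)" if "x \<in> V1 H" for x
        using eq that by (auto simp: \<Phi>_def fun_eq_iff restrict_def split: if_splits)
      then have "\<forall>x\<in>V1 K. h x = h' x" unfolding fg(1)[symmetric] by blast
      then have "h = h'"
        using hk by (intro PiE_ext[of h "V1 K" "\<lambda>_. V1 G" h']) (auto simp: Hom_def)
      have "k (g x) = k' (g x)" if "x \<in> V2 H" for x
        using eq that by (auto simp: \<Phi>_def fun_eq_iff restrict_def split: if_splits)
      then have "\<forall>x\<in>V2 K. k x = k' x" unfolding fg(2)[symmetric] by blast
      then have "k = k'"
        using hk by (intro PiE_ext[of k "V2 K" "\<lambda>_. V2 G" k']) (auto simp: Hom_def)
      with \<open>h = h'\<close> show "h = h' \<and> k = k'" by simp
    qed
    show "\<Phi> ` Hom K G \<subseteq> Hom H G"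
    proof (rule image_subsetI, clarify)
      fix h k assume hk: "(h, k) \<in> Hom K G"
      have "(h (f x), k (g y)) \<in> edges G" if "(x, y) \<in> edges H" for x y
      proof -
        have "(f x, g y) \<in> edges K" using that fg(3) by force
        then show ?thesis using hk by (auto simp: Hom_def)
      qed
      moreover have "h (f x) \<in> V1 G" if "x \<in> V1 H" for x using hk fg(1) that by (auto simp: Hom_def)
      moreover have "k (g x) \<in> V2 G" if "x \<in> V2 H" for x using hk fg(2) that by (auto simp: Hom_def)
      ultimately show "\<Phi> (h, k) \<in> Hom H G"
        using EH by (auto simp: \<Phi>_def Hom_def subset_iff)
    qed
    have "Hom H G \<subseteq> (V1 H \<rightarrow>\<^sub>E V1 G) \<times> (V2 H \<rightarrow>\<^sub>E V2 G)" by (auto simp: Hom_def)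
    then show "finite (Hom H G)"
      using H G by (auto simp: bigraphs_def intro!: finite_PiE elim!: finite_subset)
  qed
qed

section \<open>Class sizes, and bounds on densities that hold with high probability\<close>

definition part_size :: "real \<Rightarrow> nat \<Rightarrow> nat" where
  "part_size a n = nat \<lceil>real n powr a\<rceil>"

lemma part_size_ge: "real n powr a \<le> real (part_size a n)"
  unfolding part_size_def by linarith

text \<open>Rounding up adds less than 1, and \<open>real n powr a\<close> is itself at least
  1.\<close>

lemma part_size_le:
  assumes "1 \<le> n" "0 \<le> a"
  shows "real (part_size a n) \<le> 2 * real n powr a"
proof -
  have "1 \<le> real n powr a" using assms by (simp add: ge_one_powr_ge_zero)
  then show ?thesis unfolding part_size_def by linarith
qed

lemma part_size_at_top:
  assumes "0 < a"
  shows "filterlim (part_size a) at_top sequentially"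
proof -
  have "filterlim (\<lambda>n. real n powr a) at_top sequentially" using assms by real_asymp
  then have "filterlim (\<lambda>n. real (part_size a n)) at_top sequentially"
    by (rule filterlim_at_top_mono) (simp add: part_size_ge)
  then show ?thesis
    by (simp add: filterlim_sequentially_iff_filterlim_real)
qed

lemma bigraph_pmf_eq:
  "bigraph_pmf n \<beta> \<alpha> = binomial_bigraph {..<part_size \<alpha> n} {..<part_size (1 - \<alpha>) n} (real n powr (\<beta> - 1))"
  by (simp add: bigraph_pmf_def binomial_bigraph_def part_size_def Let_def)

text \<open>Markov's inequality; the extra factor \<open>real n powr \<delta>\<close> in the
  threshold outgrows the constant factorials of the first moment.\<close>

lemma prob_hom_density_ge:
  assumes H: "H \<in> bigraphs" and \<beta>: "\<beta> < 1" and \<alpha>: "0 < \<alpha>" "\<alpha> < 1" and \<delta>: "0 < \<delta>"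
  shows "(\<lambda>n. measure_pmf.prob (bigraph_pmf n \<beta> \<alpha>)
    {G. real n powr (- (1 - \<beta>) * R \<beta> \<alpha> H + \<delta>) \<le> hom_density H G}) \<longlonglongrightarrow> 0"
proof (rule tendsto_sandwich[OF always_eventually _ tendsto_const])
  let ?C = "fact (card (V1 H)) * fact (card (V2 H)) :: real"
  show "\<forall>\<^sub>F n in sequentially. measure_pmf.prob (bigraph_pmf n \<beta> \<alpha>)
    {G. real n powr (- (1 - \<beta>) * R \<beta> \<alpha> H + \<delta>) \<le> hom_density H G} \<le> ?C * real n powr (- \<delta>)"
    using eventually_ge_at_top[of 1]
  proof eventually_elim
    case (elim n)
    let ?x = "real n powr (- (1 - \<beta>) * R \<beta> \<alpha> H)"
    have "measure_pmf.prob (bigraph_pmf n \<beta> \<alpha>) {G \<in> space (bigraph_pmf n \<beta> \<alpha>).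
          ?x * real n powr \<delta> \<le> hom_density H G}
        \<le> measure_pmf.expectation (bigraph_pmf n \<beta> \<alpha>) (hom_density H) / (?x * real n powr \<delta>)"
    proof (rule integral_Markov_inequality_measure[where A = "{}"])
      show "integrable (measure_pmf (bigraph_pmf n \<beta> \<alpha>)) (hom_density H)"
        unfolding bigraph_pmf_eq by (intro integrable_measure_pmf_finite finite_set_binomial_bigraph) auto
    qed (use elim in \<open>auto simp: hom_density_def\<close>)
    also have "\<dots> \<le> ?C * ?x / (?x * real n powr \<delta>)"
      unfolding bigraph_pmf_eq using elim H \<beta> \<alpha> part_size_ge
      by (intro divide_right_mono expectation_hom_density_le) auto
    also have "\<dots> = ?C * real n powr (- \<delta>)"
      using elim by (simp add: powr_minus field_simps)
    finally show ?case using elim by (simp add: powr_add)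
  qed
  show "(\<lambda>n. ?C * real n powr (- \<delta>)) \<longlonglongrightarrow> 0"
    using \<delta> by real_asymp
qed auto

text \<open>The second moment gives many copies of an optimal image \<open>K\<close>, each of them
  yields a homomorphism from \<open>H\<close>, and normalising by the number of all maps from
  \<open>H\<close> gives the exponent of \<open>R\<close> up to a constant factor.\<close>

lemma prob_hom_density_less:
  assumes H: "H \<in> bigraphs" and \<beta>: "0 < \<beta>" "\<beta> < 1" and \<alpha>: "0 < \<alpha>" "\<alpha> < 1"
  obtains c where "0 < c" "(\<lambda>n. measure_pmf.prob (bigraph_pmf n \<beta> \<alpha>)
    {G. hom_density H G < c * real n powr (- (1 - \<beta>) * R \<beta> \<alpha> H)}) \<longlonglongrightarrow> 0"
proof -
  obtain K where K: "K \<in> hom_images H" "R \<beta> \<alpha> H = image_cost \<beta> \<alpha> H K"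
    using R_attained[OF H] \<beta>(2) by (metis less_irrefl)
  have Kb: "K \<in> bigraphs" using hom_imagesD(4)[OF K(1) H] .
  let ?a = "card (V1 H)" and ?b = "card (V2 H)"
  let ?v = "card (V1 K)" and ?w = "card (V2 K)" and ?e = "card (edges K)"
  \<comment> \<open>One factor 1/2 comes from the Chebyshev threshold, one for each vertex of
    \<open>K\<close> from counting injective maps, and one for each vertex lost from
    \<open>H\<close> to \<open>K\<close> from rounding up the class sizes.\<close>
  define c :: real where "c = 1 / 2 ^ (?a + ?b + 1)"
  define C where "C = 4 * 2 ^ (?v + ?w + ?e) * real (?v ^ ?v * ?w ^ ?w)"
  have "(\<lambda>n. measure_pmf.prob (bigraph_pmf n \<beta> \<alpha>)
    {G. hom_density H G < c * real n powr (- (1 - \<beta>) * R \<beta> \<alpha> H)}) \<longlonglongrightarrow> 0"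
  proof (rule tendsto_sandwich[OF always_eventually _ tendsto_const])
    have "eventually (\<lambda>n. 2 * ?v \<le> part_size \<alpha> n) sequentially"
      "eventually (\<lambda>n. 2 * ?w \<le> part_size (1 - \<alpha>) n) sequentially"
      using part_size_at_top[of \<alpha>] part_size_at_top[of "1 - \<alpha>"] \<alpha> by (auto simp: filterlim_at_top)
    with eventually_ge_at_top[of 1]
    show "\<forall>\<^sub>F n in sequentially. measure_pmf.prob (bigraph_pmf n \<beta> \<alpha>)
      {G. hom_density H G < c * real n powr (- (1 - \<beta>) * R \<beta> \<alpha> H)} \<le> C / real n powr \<beta>"
    proof eventually_elim
      case (elim n)
      let ?N = "part_size \<alpha> n" and ?N' = "part_size (1 - \<alpha>) n" and ?p = "real n powr (\<beta> - 1)"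
      have n: "1 \<le> n" by fact
      have N: "real n powr \<alpha> \<le> real ?N" "real ?N \<le> 2 * real n powr \<alpha>"
        and N': "real n powr (1 - \<alpha>) \<le> real ?N'" "real ?N' \<le> 2 * real n powr (1 - \<alpha>)"
        using n \<alpha> by (auto intro: part_size_ge part_size_le)
      have Npos: "0 < real ?N" "0 < real ?N'"
        using n by (auto intro!: less_le_trans[OF _ N(1)] less_le_trans[OF _ N'(1)] simp del: of_nat_0_less_iff)
      \<comment> \<open>By \<open>optimal_image_subgraph\<close> the exponent is at least \<beta>
        for every nonempty \<open>F\<close>, so \<open>L\<close> can be
        \<open>real n powr \<beta>\<close>; the failure probability vanishes because \<beta> is
        positive.\<close>
      have dense: "real n powr \<beta> \<le> real (card {..<?N}) ^ card (fst ` F) * real (card {..<?N'}) ^ card (snd ` F) * ?p ^ card F"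
        if F: "F \<subseteq> edges K" "F \<noteq> {}" for F
      proof -
        have "real n powr \<beta> \<le> real n powr (\<alpha> * real (card (fst ` F)) + (1 - \<alpha>) * real (card (snd ` F)) + (\<beta> - 1) * real (card F))"
          using optimal_image_subgraph[OF H \<beta>(2) K F] n by (intro powr_mono) (auto simp: algebra_simps)
        also have "\<dots> = (real n powr \<alpha>) ^ card (fst ` F) * (real n powr (1 - \<alpha>)) ^ card (snd ` F) * ?p ^ card F"
          using n by (simp add: powr_add powr_powr flip: powr_realpow)
        also have "\<dots> \<le> real ?N ^ card (fst ` F) * real ?N' ^ card (snd ` F) * ?p ^ card F"
          using N N' by (intro mult_right_mono mult_mono power_mono) auto
        finally show ?thesis by simp
      qed
      \<comment> \<open>Converts the density threshold for \<open>H\<close> into the count threshold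
        for \<open>K\<close>. The exponents match because \<open>K\<close> attains the
        minimum.\<close>
      have bound: "c * real n powr (- (1 - \<beta>) * R \<beta> \<alpha> H) * (real ?N ^ ?a * real ?N' ^ ?b)
          \<le> (real ?N / 2) ^ ?v * (real ?N' / 2) ^ ?w * ?p ^ ?e / 2"
      proof -
        define s where "s = ?a - ?v"
        define t where "t = ?b - ?w"
        have st: "?a = ?v + s" "?b = ?w + t"
          using hom_imagesD[OF K(1) H] by (simp_all add: s_def t_def)
        have ex: "- (1 - \<beta>) * R \<beta> \<alpha> H = (\<beta> - 1) * real ?e + (- \<alpha> * real s + - (1 - \<alpha>) * real t)"
          using image_cost_scaled[of \<beta> \<alpha> H K] \<beta> unfolding K(2) st by (simp add: algebra_simps)
        have "real ?N ^ s * real ?N' ^ t \<le> (2 * real n powr \<alpha>) ^ s * (2 * real n powr (1 - \<alpha>)) ^ t"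
          using N N' by (intro mult_mono power_mono) auto
        also have "\<dots> = 2 ^ (s + t) / (real n powr (- \<alpha> * real s + - (1 - \<alpha>) * real t))"
        proof -
          have "(2 * real n powr \<alpha>) ^ s * (2 * real n powr (1 - \<alpha>)) ^ t
              = 2 ^ (s + t) * ((real n powr \<alpha>) ^ s * (real n powr (1 - \<alpha>)) ^ t)"
            by (simp add: power_mult_distrib power_add)
          also have "(real n powr \<alpha>) ^ s * (real n powr (1 - \<alpha>)) ^ t = real n powr (- (- \<alpha> * real s + - (1 - \<alpha>) * real t))"
            using n by (simp add: powr_powr algebra_simps flip: powr_realpow powr_add)
          finally show ?thesis by (simp only: powr_minus divide_inverse)
        qed
        finally have le: "real n powr (- \<alpha> * real s + - (1 - \<alpha>) * real t) * (real ?N ^ s * real ?N' ^ t) \<le> 2 ^ (s + t)"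
          using n by (simp add: field_simps)
        have "c * real n powr (- (1 - \<beta>) * R \<beta> \<alpha> H) * (real ?N ^ ?a * real ?N' ^ ?b)
            = c * ?p ^ ?e * (real ?N ^ ?v * real ?N' ^ ?w) *
              (real n powr (- \<alpha> * real s + - (1 - \<alpha>) * real t) * (real ?N ^ s * real ?N' ^ t))"
          unfolding ex unfolding st power_add powr_add using n by (simp add: powr_powr flip: powr_realpow)
        also have "\<dots> \<le> c * ?p ^ ?e * (real ?N ^ ?v * real ?N' ^ ?w) * 2 ^ (s + t)"
          using le by (intro mult_left_mono) (auto simp: c_def)
        also have "\<dots> = (real ?N / 2) ^ ?v * (real ?N' / 2) ^ ?w * ?p ^ ?e / 2"
          unfolding c_def st by (simp add: power_add power_divide mult_ac)
        finally show ?thesis .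
      qed
      have "measure_pmf.prob (bigraph_pmf n \<beta> \<alpha>) {G. hom_density H G < c * real n powr (- (1 - \<beta>) * R \<beta> \<alpha> H)}
          \<le> measure_pmf.prob (bigraph_pmf n \<beta> \<alpha>) {G. real (card (Hom K G)) \<le> (real ?N / 2) ^ ?v * (real ?N' / 2) ^ ?w * ?p ^ ?e / 2}"
      proof (rule measure_pmf.finite_measure_mono_AE; (simp only: AE_measure_pmf_iff mem_Collect_eq)?; (intro ballI impI)?)
        fix G assume "G \<in> set_pmf (bigraph_pmf n \<beta> \<alpha>)"
          and less: "hom_density H G < c * real n powr (- (1 - \<beta>) * R \<beta> \<alpha> H)"
        then have V: "V1 G = {..<?N}" "V2 G = {..<?N'}" "edges G \<subseteq> {..<?N} \<times> {..<?N'}"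
          unfolding bigraph_pmf_eq by (auto dest: set_binomial_bigraphD)
        then have "G \<in> bigraphs" by (auto simp: bigraphs_def)
        then have "real (card (Hom K G)) \<le> real (card (Hom H G))"
          using card_Hom_image_le[OF H K(1)] by simp
        also have "\<dots> = hom_density H G * (real ?N ^ ?a * real ?N' ^ ?b)"
          using Npos V by (simp add: hom_density_def)
        also have "\<dots> \<le> c * real n powr (- (1 - \<beta>) * R \<beta> \<alpha> H) * (real ?N ^ ?a * real ?N' ^ ?b)"
          using less by (intro mult_right_mono) (auto simp: less_imp_le)
        also note bound
        finally show "real (card (Hom K G)) \<le> (real ?N / 2) ^ ?v * (real ?N' / 2) ^ ?w * ?p ^ ?e / 2" .
      qed simp
      also have "\<dots> \<le> C / real n powr \<beta>"
      proof -
        have "?p \<le> 1" using powr_mono[of "\<beta> - 1" 0 "real n"] n \<beta> by simp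
        then show ?thesis
          using prob_few_homs_le[OF Kb _ _ _ _ _ _ _ _ _ dense] n elim Npos
          by (simp add: bigraph_pmf_eq C_def)
      qed
      finally show ?case .
    qed
    show "(\<lambda>n. C / real n powr \<beta>) \<longlonglongrightarrow> 0"
      using \<beta> by real_asymp
  qed auto
  then show ?thesis using that[of c] by (simp add: c_def)
qed

text \<open>Logarithms turn the two power bounds into additive errors. Positivity is kept inside the
  event because the logarithm of a zero density carries no information.\<close>

lemma prob_log_density_far:
  assumes H: "H \<in> bigraphs" and \<beta>: "0 < \<beta>" "\<beta> < 1" and \<alpha>: "0 < \<alpha>" "\<alpha> < 1" and \<delta>: "0 < \<delta>"
  shows "(\<lambda>n. measure_pmf.prob (bigraph_pmf n \<beta> \<alpha>)
    {G. \<not> (0 < hom_density H G \<and> \<bar>log_density H G / ln (real n) - (1 - \<beta>) * R \<beta> \<alpha> H\<bar> \<le> \<delta>)}) \<longlonglongrightarrow> 0"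
proof -
  let ?r = "(1 - \<beta>) * R \<beta> \<alpha> H"
  obtain c where c: "0 < c" and low: "(\<lambda>n. measure_pmf.prob (bigraph_pmf n \<beta> \<alpha>)
    {G. hom_density H G < c * real n powr (- (1 - \<beta>) * R \<beta> \<alpha> H)}) \<longlonglongrightarrow> 0"
    using prob_hom_density_less[OF H \<beta> \<alpha>] by blast
  let ?L = "\<lambda>n. {G. hom_density H G < c * real n powr (- (1 - \<beta>) * R \<beta> \<alpha> H)}"
  let ?U = "\<lambda>n. {G. real n powr (- (1 - \<beta>) * R \<beta> \<alpha> H + \<delta>) \<le> hom_density H G}"
  show ?thesis
  proof (rule tendsto_sandwich[OF always_eventually _ tendsto_const])
    \<comment> \<open>The constant \<open>c\<close> of the lower bound is absorbed into the margin
      \<delta> of the exponent.\<close>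
    have "eventually (\<lambda>n. real n powr (- \<delta>) < c) sequentially"
    proof (rule order_tendstoD(2))
      show "(\<lambda>n. real n powr (- \<delta>)) \<longlonglongrightarrow> 0" using \<delta> by real_asymp
    qed (fact c)
    with eventually_ge_at_top[of 2]
    show "\<forall>\<^sub>F n in sequentially. measure_pmf.prob (bigraph_pmf n \<beta> \<alpha>)
        {G. \<not> (0 < hom_density H G \<and> \<bar>log_density H G / ln (real n) - ?r\<bar> \<le> \<delta>)}
      \<le> measure_pmf.prob (bigraph_pmf n \<beta> \<alpha>) (?L n) + measure_pmf.prob (bigraph_pmf n \<beta> \<alpha>) (?U n)"
    proof eventually_elim
      case (elim n)
      have ln: "0 < ln (real n)" using elim by simp
      have "{G. \<not> (0 < hom_density H G \<and> \<bar>log_density H G / ln (real n) - ?r\<bar> \<le> \<delta>)} \<subseteq> ?L n \<union> ?U n"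
      proof (rule subsetI, rule ccontr)
        fix G assume bad: "G \<in> {G. \<not> (0 < hom_density H G \<and> \<bar>log_density H G / ln (real n) - ?r\<bar> \<le> \<delta>)}"
          and "G \<notin> ?L n \<union> ?U n"
        then have t: "c * real n powr (- ?r) \<le> hom_density H G" "hom_density H G < real n powr (- ?r + \<delta>)"
          by (simp_all only: Un_iff mem_Collect_eq de_Morgan_disj not_less not_le mult_minus_left)
        have "0 < c * real n powr (- ?r)" using c elim by simp
        with t have pos: "0 < hom_density H G" by linarith
        have "real n powr (- ?r - \<delta>) = real n powr (- \<delta>) * real n powr (- ?r)"
          by (simp add: algebra_simps flip: powr_add)
        also have "\<dots> \<le> c * real n powr (- ?r)" using elim by (intro mult_right_mono) auto
        finally have "real n powr (- ?r - \<delta>) \<le> hom_density H G" using t by linarith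
        then have "(- ?r - \<delta>) * ln (real n) \<le> ln (hom_density H G)"
          using elim pos by (subst (asm) ln_le_cancel_iff[symmetric]) (auto simp: ln_powr)
        moreover have "ln (hom_density H G) \<le> (- ?r + \<delta>) * ln (real n)"
          using elim pos t(2) by (subst (asm) ln_less_cancel_iff[symmetric]) (auto simp: ln_powr)
        ultimately have "(?r - \<delta>) * ln (real n) \<le> log_density H G" "log_density H G \<le> (?r + \<delta>) * ln (real n)"
          unfolding log_density_def by (auto simp: algebra_simps)
        then have "?r - \<delta> \<le> log_density H G / ln (real n)" "log_density H G / ln (real n) \<le> ?r + \<delta>"
          using ln by (auto simp: pos_le_divide_eq pos_divide_le_eq)
        then show False using bad pos by (auto simp: abs_le_iff)
      qed
      then have "measure_pmf.prob (bigraph_pmf n \<beta> \<alpha>) {G. \<not> (0 < hom_density H G \<and> \<bar>log_density H G / ln (real n) - ?r\<bar> \<le> \<delta>)}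
        \<le> measure_pmf.prob (bigraph_pmf n \<beta> \<alpha>) (?L n \<union> ?U n)"
        by (intro measure_pmf.finite_measure_mono) auto
      also have "\<dots> \<le> measure_pmf.prob (bigraph_pmf n \<beta> \<alpha>) (?L n) + measure_pmf.prob (bigraph_pmf n \<beta> \<alpha>) (?U n)"
        by (intro measure_Un_le) auto
      finally show ?case .
    qed
    show "(\<lambda>n. measure_pmf.prob (bigraph_pmf n \<beta> \<alpha>) (?L n) + measure_pmf.prob (bigraph_pmf n \<beta> \<alpha>) (?U n)) \<longlonglongrightarrow> 0"
      using tendsto_add[OF low prob_hom_density_ge[OF H \<beta>(2) \<alpha> \<delta>]] by simp
  qed auto
qed

section \<open>Convergence of the ratio, and membership in the closure\<close>

lemma P1_in_bigraphs: "P1 \<in> bigraphs"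
  by (simp add: P1_def bigraphs_def)

lemma Hom_P1_nonempty_imp:
  assumes "Hom P1 G \<noteq> {}" shows "edges G \<noteq> {}"
  using assms by (auto simp: Hom_def P1_def)

text \<open>Applied in contrapositive form: a nonzero log density of the single edge excludes the
  complete graph, so that \<open>log_ratio\<close> is the actual quotient.\<close>

lemma log_density_P1_complete:
  assumes "G \<in> bigraphs" "edges G = V1 G \<times> V2 G" "edges G \<noteq> {}"
  shows "log_density P1 G = 0"
proof -
  have "Hom P1 G = ({0} \<rightarrow>\<^sub>E V1 G) \<times> ({0} \<rightarrow>\<^sub>E V2 G)"
    using assms(2) by (auto simp: Hom_def P1_def PiE_iff extensional_def)
  then have "card (Hom P1 G) = card (V1 G) * card (V2 G)"
    by (simp add: card_cartesian_product card_funcsetE)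
  moreover have "card (V1 G) \<noteq> 0" "card (V2 G) \<noteq> 0"
    using assms by (auto simp: bigraphs_def)
  ultimately show ?thesis by (simp add: log_density_def hom_density_def P1_def)
qed

lemma set_bigraph_pmf: "G \<in> set_pmf (bigraph_pmf n \<beta> \<alpha>) \<Longrightarrow> G \<in> bigraphs"
  unfolding bigraph_pmf_eq by (auto dest: set_binomial_bigraphD simp: bigraphs_def)

text \<open>Continuity of the quotient at \<open>(c * r, c)\<close>, in a form that can be applied
  outcome by outcome.\<close>

lemma divide_close:
  fixes c r \<epsilon> :: real
  assumes "0 < c" "0 < \<epsilon>"
  obtains \<delta> where "0 < \<delta>" "\<And>x y. \<bar>x - c * r\<bar> \<le> \<delta> \<Longrightarrow> \<bar>y - c\<bar> \<le> \<delta> \<Longrightarrow> 0 < y \<and> \<bar>x / y - r\<bar> < \<epsilon>"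
proof -
  \<comment> \<open>The first bound keeps \<open>y\<close> at least \<open>c / 2\<close>; the second
    makes the error of \<open>x - r * y\<close> at most \<open>c * \<epsilon> / 4\<close>, which is
    less than \<open>y * \<epsilon>\<close>.\<close>
  define \<delta> where "\<delta> = min (c / 2) (c * \<epsilon> / (4 * (1 + \<bar>r\<bar>)))"
  have \<delta>: "0 < \<delta>" "\<delta> \<le> c / 2"
    unfolding \<delta>_def using assms by (simp, intro min.cobounded1)
  have "\<delta> \<le> c * \<epsilon> / (4 * (1 + \<bar>r\<bar>))" by (simp add: \<delta>_def)
  then have small: "\<delta> * (1 + \<bar>r\<bar>) \<le> c * \<epsilon> / 4" by (simp add: field_simps)
  have "0 < y \<and> \<bar>x / y - r\<bar> < \<epsilon>" if x: "\<bar>x - c * r\<bar> \<le> \<delta>" and y: "\<bar>y - c\<bar> \<le> \<delta>" for x y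
  proof
    have yc: "c / 2 \<le> y" using y \<delta> by linarith
    then show pos: "0 < y" using assms by linarith
    have "x - r * y = (x - c * r) - r * (y - c)" by (simp add: algebra_simps)
    then have "\<bar>x - r * y\<bar> \<le> \<bar>x - c * r\<bar> + \<bar>r\<bar> * \<bar>y - c\<bar>"
      using abs_triangle_ineq4[of "x - c * r" "r * (y - c)"] by (simp add: abs_mult)
    also have "\<dots> \<le> \<delta> + \<bar>r\<bar> * \<delta>" using x y by (intro add_mono mult_left_mono) auto
    also have "\<dots> \<le> c * \<epsilon> / 4" using small by (simp add: algebra_simps)
    also have "\<dots> < c / 2 * \<epsilon>" using assms by simp
    also have "\<dots> \<le> y * \<epsilon>" using yc assms by (intro mult_right_mono) auto
    finally have "\<bar>x - r * y\<bar> / y < \<epsilon>" using pos by (simp add: pos_divide_less_eq mult.commute)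
    moreover have "x / y - r = (x - r * y) / y" using pos by (simp add: field_simps)
    ultimately show "\<bar>x / y - r\<bar> < \<epsilon>" using pos by (simp add: abs_divide)
  qed
  with \<delta>(1) show ?thesis using that by blast
qed

text \<open>Numerator and denominator, both divided by ln n, concentrate at (1 - \<beta>) R and (1 -
  \<beta>); the scaling by ln n cancels in the quotient.\<close>

lemma conv_in_prob_log_ratio_less_1:
  assumes H: "H \<in> bigraphs" and \<beta>: "0 < \<beta>" "\<beta> < 1" and \<alpha>: "0 < \<alpha>" "\<alpha> < 1"
  shows "conv_in_prob (\<lambda>n. bigraph_pmf n \<beta> \<alpha>) (\<lambda>_. log_ratio_ext H) (R \<beta> \<alpha> H)"
  unfolding conv_in_prob_def
proof (intro allI impI)
  fix \<epsilon> :: real assume \<epsilon>: "0 < \<epsilon>"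
  let ?r = "R \<beta> \<alpha> H"
  obtain \<delta> where \<delta>: "0 < \<delta>"
    and close: "\<And>x y. \<bar>x - (1 - \<beta>) * ?r\<bar> \<le> \<delta> \<Longrightarrow> \<bar>y - (1 - \<beta>)\<bar> \<le> \<delta> \<Longrightarrow> 0 < y \<and> \<bar>x / y - ?r\<bar> < \<epsilon>"
    using divide_close[of "1 - \<beta>" \<epsilon> ?r] \<beta> \<epsilon> by auto
  let ?bad = "\<lambda>H n. {G. \<not> (0 < hom_density H G \<and> \<bar>log_density H G / ln (real n) - (1 - \<beta>) * R \<beta> \<alpha> H\<bar> \<le> \<delta>)}"
  show "(\<lambda>n. measure_pmf.prob (bigraph_pmf n \<beta> \<alpha>) {G. ereal \<epsilon> < \<bar>log_ratio_ext H G - ereal ?r\<bar>}) \<longlonglongrightarrow> 0"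
  proof (rule tendsto_sandwich[OF always_eventually _ tendsto_const])
    show "\<forall>\<^sub>F n in sequentially. measure_pmf.prob (bigraph_pmf n \<beta> \<alpha>) {G. ereal \<epsilon> < \<bar>log_ratio_ext H G - ereal ?r\<bar>}
      \<le> measure_pmf.prob (bigraph_pmf n \<beta> \<alpha>) (?bad H n) + measure_pmf.prob (bigraph_pmf n \<beta> \<alpha>) (?bad P1 n)"
      using eventually_ge_at_top[of 2]
    proof eventually_elim
      case (elim n)
      have ln: "0 < ln (real n)" using elim by simp
      have "measure_pmf.prob (bigraph_pmf n \<beta> \<alpha>) {G. ereal \<epsilon> < \<bar>log_ratio_ext H G - ereal ?r\<bar>}
        \<le> measure_pmf.prob (bigraph_pmf n \<beta> \<alpha>) (?bad H n \<union> ?bad P1 n)"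
      proof (rule measure_pmf.finite_measure_mono_AE; (subst AE_measure_pmf_iff)?; (intro ballI impI)?)
        fix G assume G: "G \<in> set_pmf (bigraph_pmf n \<beta> \<alpha>)" and far: "G \<in> {G. ereal \<epsilon> < \<bar>log_ratio_ext H G - ereal ?r\<bar>}"
        show "G \<in> ?bad H n \<union> ?bad P1 n"
        proof (rule ccontr)
          assume "G \<notin> ?bad H n \<union> ?bad P1 n"
          then have x: "\<bar>log_density H G / ln (real n) - (1 - \<beta>) * ?r\<bar> \<le> \<delta>"
            and y: "\<bar>log_density P1 G / ln (real n) - (1 - \<beta>)\<bar> \<le> \<delta>" and pos: "0 < hom_density P1 G"
            using R_P1[of \<beta> \<alpha>] \<beta> by auto
          \<comment> \<open>Positive edge density excludes the edgeless graphs, where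
            \<open>log_ratio_ext\<close> is infinite.\<close>
          have "Hom P1 G \<noteq> {}" using pos by (auto simp: hom_density_def)
          then have ne: "edges G \<noteq> {}" by (rule Hom_P1_nonempty_imp)
          from close[OF x y] have y0: "0 < log_density P1 G / ln (real n)"
            and lt: "\<bar>log_density H G / ln (real n) / (log_density P1 G / ln (real n)) - ?r\<bar> < \<epsilon>" by auto
          from y0 have "log_density P1 G \<noteq> 0" by auto
          then have "edges G \<noteq> V1 G \<times> V2 G"
            using log_density_P1_complete[OF set_bigraph_pmf[OF G]] ne by auto
          then have "log_ratio_ext H G = ereal (log_density H G / log_density P1 G)"
            using ne by (simp add: log_ratio_ext_def log_ratio_def)
          with lt ln far show False by simp
        qed
      qed auto
      also have "\<dots> \<le> measure_pmf.prob (bigraph_pmf n \<beta> \<alpha>) (?bad H n) + measure_pmf.prob (bigraph_pmf n \<beta> \<alpha>) (?bad P1 n)"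
        by (intro measure_Un_le) auto
      finally show ?case .
    qed
    show "(\<lambda>n. measure_pmf.prob (bigraph_pmf n \<beta> \<alpha>) (?bad H n) + measure_pmf.prob (bigraph_pmf n \<beta> \<alpha>) (?bad P1 n)) \<longlonglongrightarrow> 0"
      using tendsto_add[OF prob_log_density_far[OF H \<beta> \<alpha> \<delta>] prob_log_density_far[OF P1_in_bigraphs \<beta> \<alpha> \<delta>]] by simp
  qed auto
qed

text \<open>The edge probability is 1, so the graph is almost surely complete and the convention for
  complete graphs gives the limit exactly.\<close>

lemma conv_in_prob_log_ratio_1:
  shows "conv_in_prob (\<lambda>n. bigraph_pmf n 1 \<alpha>) (\<lambda>_. log_ratio_ext H) (R 1 \<alpha> H)"
  unfolding conv_in_prob_def
proof (intro allI impI)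
  fix \<epsilon> :: real assume \<epsilon>: "0 < \<epsilon>"
  show "(\<lambda>n. measure_pmf.prob (bigraph_pmf n 1 \<alpha>) {G. ereal \<epsilon> < \<bar>log_ratio_ext H G - ereal (R 1 \<alpha> H)\<bar>}) \<longlonglongrightarrow> 0"
  proof (rule tendsto_eventually)
    show "\<forall>\<^sub>F n in sequentially. measure_pmf.prob (bigraph_pmf n 1 \<alpha>) {G. ereal \<epsilon> < \<bar>log_ratio_ext H G - ereal (R 1 \<alpha> H)\<bar>} = 0"
      \<comment> \<open>\<open>n = 0\<close> must be left out: \<open>0 powr x\<close> is 0, which
        makes both classes empty.\<close>
      using eventually_ge_at_top[of 1]
    proof eventually_elim
      case (elim n)
      let ?A = "{..<part_size \<alpha> n}" and ?B = "{..<part_size (1 - \<alpha>) n}"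
      have ne: "0 < part_size \<alpha> n" "0 < part_size (1 - \<alpha>) n"
        using elim by (auto simp: part_size_def)
      have "AE G in bigraph_pmf n 1 \<alpha>. ?A \<times> ?B \<subseteq> edges G"
      proof -
        have "measure_pmf.prob (bigraph_pmf n 1 \<alpha>) {G. ?A \<times> ?B \<subseteq> edges G} = 1"
          unfolding bigraph_pmf_eq using elim by (subst prob_binomial_bigraph_edges) auto
        then show ?thesis by (subst (asm) measure_pmf.prob_eq_1) auto
      qed
      then have "\<not> ereal \<epsilon> < \<bar>log_ratio_ext H G - ereal (R 1 \<alpha> H)\<bar>" if "G \<in> set_pmf (bigraph_pmf n 1 \<alpha>)" for G
      proof -
        have "V1 G = ?A" "V2 G = ?B" "edges G \<subseteq> ?A \<times> ?B"
          using that unfolding bigraph_pmf_eq by (auto dest: set_binomial_bigraphD)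
        moreover have "?A \<times> ?B \<subseteq> edges G"
          using \<open>AE G in bigraph_pmf n 1 \<alpha>. ?A \<times> ?B \<subseteq> edges G\<close> that by (simp add: AE_measure_pmf_iff)
        ultimately have "edges G = V1 G \<times> V2 G" "edges G \<noteq> {}"
          using ne by auto
        then show ?thesis using \<epsilon> by (simp add: log_ratio_ext_def log_ratio_def R_def)
      qed
      then show ?case by (auto simp: measure_pmf_zero_iff disjoint_iff)
    qed
  qed
qed

lemma conv_in_prob_log_ratio:
  assumes "0 < \<beta>" "\<beta> \<le> 1" "0 < \<alpha>" "\<alpha> < 1" "H \<in> bigraphs0"
  shows "conv_in_prob (\<lambda>n. bigraph_pmf n \<beta> \<alpha>) (\<lambda>_. log_ratio_ext H) (R \<beta> \<alpha> H)"
  using assms conv_in_prob_log_ratio_1 conv_in_prob_log_ratio_less_1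
  by (cases "\<beta> = 1") (auto simp: bigraphs0_def)

text \<open>By the union bound, for finitely many \<open>H\<close> at once some graph in the support has all its
  parameters close to the limits.\<close>

lemma conv_in_prob_imp_limit_params:
  assumes conv: "\<And>H. H \<in> bigraphs0 \<Longrightarrow> conv_in_prob M (\<lambda>_. log_ratio_ext H) (r H)"
    and M: "\<And>n. set_pmf (M n) \<subseteq> bigraphs"
  shows "(\<lambda>H\<in>bigraphs0. r H) \<in> limit_params"
proof -
  let ?X = "product_topology (\<lambda>_. euclideanreal) bigraphs0"
  have P1: "P1 \<in> bigraphs0" by (simp add: P1_def bigraphs_def bigraphs0_def)
  have "\<exists>G\<in>bigraphs0. tau G \<in> T" if T: "(\<lambda>H\<in>bigraphs0. r H) \<in> T" "openin ?X T" for T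
  proof -
    \<comment> \<open>A basic open neighbourhood restricts only finitely many coordinates, which is
      what makes the union bound possible.\<close>
    obtain U where U: "finite {H \<in> bigraphs0. U H \<noteq> UNIV}" "\<And>H. H \<in> bigraphs0 \<Longrightarrow> open (U H)"
      "(\<lambda>H\<in>bigraphs0. r H) \<in> Pi\<^sub>E bigraphs0 U" "Pi\<^sub>E bigraphs0 U \<subseteq> T"
      using T unfolding openin_product_topology_alt by auto
    \<comment> \<open>\<open>P1\<close> is added so that the graph found has an edge: on edgeless
      graphs its parameter is infinite, hence far from the limit.\<close>
    define J where "J = insert P1 {H \<in> bigraphs0. U H \<noteq> UNIV}"
    have J: "finite J" "J \<subseteq> bigraphs0" using U(1) P1 by (auto simp: J_def)
    have "\<exists>\<epsilon>>0. \<forall>x. \<bar>x - r H\<bar> \<le> \<epsilon> \<longrightarrow> x \<in> U H" if H: "H \<in> bigraphs0" for H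
    proof -
      have "r H \<in> U H" using U(3) H by (auto simp: PiE_iff)
      then obtain e where "e > 0" "cball (r H) e \<subseteq> U H"
        using U(2)[OF H] unfolding open_contains_cball by blast
      then show ?thesis by (intro exI[of _ e]) (auto simp: subset_iff dist_real_def abs_minus_commute)
    qed
    then obtain \<epsilon> where \<epsilon>: "\<And>H. H \<in> bigraphs0 \<Longrightarrow> 0 < \<epsilon> H"
      "\<And>H x. H \<in> bigraphs0 \<Longrightarrow> \<bar>x - r H\<bar> \<le> \<epsilon> H \<Longrightarrow> x \<in> U H"
      by metis
    let ?bad = "\<lambda>H. {G. ereal (\<epsilon> H) < \<bar>log_ratio_ext H G - ereal (r H)\<bar>}"
    have "(\<lambda>n. \<Sum>H\<in>J. measure_pmf.prob (M n) (?bad H)) \<longlonglongrightarrow> (\<Sum>H\<in>J. 0)"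
      using conv J \<epsilon>(1) by (intro tendsto_sum) (auto simp: conv_in_prob_def)
    then have "eventually (\<lambda>n. (\<Sum>H\<in>J. measure_pmf.prob (M n) (?bad H)) < 1) sequentially"
      by (intro order_tendstoD(2)) auto
    then obtain n where n: "(\<Sum>H\<in>J. measure_pmf.prob (M n) (?bad H)) < 1"
      by (auto dest: eventually_happens)
    have "measure_pmf.prob (M n) (\<Union>H\<in>J. ?bad H) \<le> (\<Sum>H\<in>J. measure_pmf.prob (M n) (?bad H))"
      using J(1) by (intro measure_UNION_le) auto
    with n have "measure_pmf.prob (M n) (\<Union>H\<in>J. ?bad H) < 1" by linarith
    then have "measure_pmf.prob (M n) (\<Union>H\<in>J. ?bad H) \<noteq> 1" by simp
    \<comment> \<open>If every graph of the support were bad for some \<open>H\<close> in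
      \<open>J\<close>, the union of the bad events would have probability one.\<close>
    then have "\<not> set_pmf (M n) \<subseteq> (\<Union>H\<in>J. ?bad H)"
      by (subst (asm) measure_pmf.prob_eq_1) (simp_all add: AE_measure_pmf_iff subset_iff Bex_def)
    then obtain G where G: "G \<in> set_pmf (M n)" "\<And>H. H \<in> J \<Longrightarrow> G \<notin> ?bad H" by blast
    have ne: "edges G \<noteq> {}"
      using G(2)[of P1] by (auto simp: J_def log_ratio_ext_def)
    then have G0: "G \<in> bigraphs0" using G(1) M by (auto simp: bigraphs0_def)
    have "log_ratio H G \<in> U H" if "H \<in> bigraphs0" for H
    proof (cases "H \<in> J")
      case True
      then show ?thesis using G(2)[OF True] ne \<epsilon>(2)[OF that] by (simp add: log_ratio_ext_def not_less)
    qed (use that in \<open>auto simp: J_def\<close>)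
    then have "tau G \<in> T" using U(4) by (auto simp: tau_def)
    with G0 show ?thesis by blast
  qed
  then show ?thesis
    unfolding limit_params_def in_closure_of by auto
qed

theorem theorem3:
  fixes \<alpha> \<beta> :: real
  assumes "0 < \<beta>" "\<beta> \<le> 1" "0 < \<alpha>" "\<alpha> < 1"
  shows "(\<forall>H \<in> bigraphs0.
            conv_in_prob (\<lambda>n. bigraph_pmf n \<beta> \<alpha>) (\<lambda>_. log_ratio_ext H) (R \<beta> \<alpha> H))
         \<and> (\<lambda>H \<in> bigraphs0. R \<beta> \<alpha> H) \<in> limit_params"
  using assms
  by (intro conjI ballI conv_in_prob_log_ratio conv_in_prob_imp_limit_params[where M = "\<lambda>n. bigraph_pmf n \<beta> \<alpha>"])
    (auto intro: set_bigraph_pmf)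

end
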